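(* Let $(E,\mathcal E,\mu)$ be a probability space, let $\alpha>1$, $\beta=\frac{\alpha}{\alpha-1}$, and let $u\in L^1(\mu)$ satisfy $\int u\,d\mu=0$. Let $K\in[0,\infty]$ denote the best (smallest) constant such that $$\Big|\int u\,d\nu\Big|\le K\sqrt{T_\alpha(\nu\|\mu)}$$ for all probability measures $\nu$ absolutely continuous with respect to $\mu$ for which the integral $\int u\,d\nu$ exists (with $K=\infty$ if no finite constant works). For $p\ge 2$ define $K_p=K_p(u)\in[0,\infty]$ by $$K_p^{2p-2}=\sup_{r>0}\Big[r^{p-2}\int_{\{|u|\ge r\}}|u|^p\,d\mu\Big].$$ a) If $1<\alpha\le 2$, then $$c_\beta K_\beta\le K\le C_\beta K_\beta,\qquad c_\beta=\tfrac14\,\beta^{-\beta},\quad C_\beta=2\beta^\beta.$$ b) If $\alpha\ge 2$, then $$\sqrt{\tfrac{2}{\alpha}}\;\|u\|_2\le K\le\|u\|_2.$$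
   Context: For a probability measure $\nu$ absolutely continuous with respect to $\mu$ with density $f=d\nu/d\mu$, the Rényi divergence power (Tsallis distance) of order $\alpha>1$ is $T_\alpha(\nu\|\mu)=\frac{1}{\alpha-1}\left[\int f^\alpha\,d\mu-1\right]$ (value $+\infty$ allowed; when $T_\alpha(\nu\|\mu)=\infty$ the inequality imposes no condition). $\|u\|_2=\left(\int|u|^2\,d\mu\right)^{1/2}$, possibly $+\infty$. *)

theory Defs
  imports "HOL-Probability.Probability"
begin

text \<open>Powers of extended nonnegative reals with a positive real exponent, so that
  \<open>\<infinity>\<close> is sent to \<open>\<infinity>\<close>.\<close>

definition ennreal_pow :: "ennreal \<Rightarrow> real \<Rightarrow> ennreal" where
  "ennreal_pow x a = (if x = \<infinity> then \<infinity> else ennreal (enn2real x powr a))"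

text \<open>The Renyi divergence power (Tsallis distance) of \<open>N\<close> from \<open>M\<close> of order \<open>\<alpha> > 1\<close>, for
  probability measures with \<open>N\<close> absolutely continuous with respect to \<open>M\<close>. The derivative is then
  finite almost everywhere, so \<^const>\<open>enn2real\<close> loses nothing. The value lives in \<^typ>\<open>ereal\<close>
  because subtraction on \<^typ>\<open>ennreal\<close> truncates at zero.\<close>

definition tsallis :: "real \<Rightarrow> 'a measure \<Rightarrow> 'a measure \<Rightarrow> ereal" where
  "tsallis \<alpha> N M =
     ereal (1 / (\<alpha> - 1)) *
       (enn2ereal (\<integral>\<^sup>+ x. ennreal (enn2real (RN_deriv M N x) powr \<alpha>) \<partial>M) - 1)"

definition admissible_constant :: "real \<Rightarrow> 'a measure \<Rightarrow> ('a \<Rightarrow> real) \<Rightarrow> real \<Rightarrow> bool" where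
  "admissible_constant \<alpha> M u c \<longleftrightarrow>
     0 \<le> c \<and>
     (\<forall>N. prob_space N \<longrightarrow> sets N = sets M \<longrightarrow> absolutely_continuous M N \<longrightarrow>
          integrable N u \<longrightarrow> tsallis \<alpha> N M < \<infinity> \<longrightarrow>
          \<bar>\<integral>x. u x \<partial>N\<bar> \<le> c * sqrt (real_of_ereal (tsallis \<alpha> N M)))"

text \<open>The infimum of the empty set is \<open>\<infinity>\<close>; if the set is nonempty, the infimum is attained,
  since the admissible constants form a closed set.\<close>

definition best_constant :: "real \<Rightarrow> 'a measure \<Rightarrow> ('a \<Rightarrow> real) \<Rightarrow> ennreal" where
  "best_constant \<alpha> M u = Inf (ennreal ` {c. admissible_constant \<alpha> M u c})"

text \<open>The quantity \<open>K\<^sub>p\<close>, i.e. the solution of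
  \<open>K\<^sub>p\<^bsup>2p-2\<^esup> = sup\<^bsub>r>0\<^esub> r\<^bsup>p-2\<^esup> \<integral>\<^bsub>{|u| \<ge> r}\<^esub> |u|\<^bsup>p\<^esup> d\<mu>\<close>.\<close>

definition K_const :: "real \<Rightarrow> 'a measure \<Rightarrow> ('a \<Rightarrow> real) \<Rightarrow> ennreal" where
  "K_const p M u =
     ennreal_pow
       (SUP r\<in>{0<..}. ennreal (r powr (p - 2)) *
          (\<integral>\<^sup>+ x\<in>{x \<in> space M. r \<le> \<bar>u x\<bar>}. ennreal (\<bar>u x\<bar> powr p) \<partial>M))
       (1 / (2 * p - 2))"

definition L2_norm :: "'a measure \<Rightarrow> ('a \<Rightarrow> real) \<Rightarrow> ennreal" where
  "L2_norm M u = ennreal_pow (\<integral>\<^sup>+ x. ennreal (\<bar>u x\<bar>\<^sup>2) \<partial>M) (1 / 2)"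

end

theory Submission
  imports Defs
begin

text \<open>
  Write \<open>\<nu> = f \<mu>\<close> and \<open>s = \<alpha> - 1\<close>. Since \<open>u\<close> is centred and \<open>f\<close> has mean one,
  \<open>\<integral>u d\<nu> = \<integral>u (f - 1) d\<mu>\<close> and \<open>T\<^sub>\<alpha> = \<integral>\<Phi>(f) d\<mu>\<close>, where
  \<open>\<Phi>(x) = (x\<^sup>\<alpha> - 1 - \<alpha>(x - 1)) / s\<close> is a convex function vanishing to second order at \<open>1\<close>.
  So \<open>\<integral>u d\<nu>\<close> is compared with \<open>\<surd>T\<^sub>\<alpha>\<close> according to the growth of \<open>\<Phi>\<close>: quadratic near
  \<open>1\<close>, and of order \<open>x\<^sup>\<alpha>\<close> at infinity. Lemma \<open>admissible_constant_iff_density\<close> makes this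
  translation, after which each of the four inequalities concerns densities only.

  For \<open>\<alpha> \<ge> 2\<close>, Bernoulli's inequality gives \<open>f\<^sup>\<alpha> - f \<ge> s (f\<^sup>2 - f)\<close>, which integrates to
  \<open>T\<^sub>\<alpha> \<ge> \<parallel>f - 1\<parallel>\<^sub>2\<^sup>2\<close>; Cauchy-Schwarz yields \<open>K \<le> \<parallel>u\<parallel>\<^sub>2\<close> (\<open>admissible_constant_L2\<close>). In the
  other direction, take \<open>f = 1 + \<epsilon> v\<close> with \<open>v\<close> a centred truncation of \<open>u\<close>: then
  \<open>T\<^sub>\<alpha> \<approx> (\<alpha>/2) \<epsilon>\<^sup>2 \<parallel>v\<parallel>\<^sub>2\<^sup>2\<close> as \<open>\<epsilon> \<rightarrow> 0\<close>, which gives the factor \<open>\<surd>(2/\<alpha>)\<close>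
  (\<open>admissible_constant_ge_L2\<close>).

  For \<open>1 < \<alpha> \<le> 2\<close>, the upper bound (\<open>admissible_constant_K_const\<close>) splits the space in three. Let
  \<open>k > 0\<close> be at least \<open>K\<^sub>\<beta>\<close>, suppose \<open>T\<^sub>\<alpha> \<le> t\<^sup>2\<close>, and put \<open>r = k t\<close>. Where \<open>f \<le> 2\<close>, \<open>\<Phi>(f)\<close> is at
  least \<open>(f - 1)\<^sup>2 / 4\<close> and Cauchy-Schwarz applies, because \<open>\<parallel>u\<parallel>\<^sub>2\<^sup>2 \<le> 2 k\<^sup>2\<close>. Where \<open>f > 2\<close> and
  \<open>\<bar>u\<bar> < r\<close>, the total mass of \<open>f\<close> bounds the contribution by \<open>r\<close>. Where \<open>f > 2\<close> and
  \<open>\<bar>u\<bar> \<ge> r\<close>, Hoelder's inequality pairs the tail of \<open>\<bar>u\<bar>\<^sup>\<beta>\<close> with \<open>f\<^sup>\<alpha> \<le> 6 \<Phi>(f)\<close>. Each of the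
  three contributions is of order \<open>k t\<close>. Cauchy-Schwarz and Hoelder are used in their pointwise
  forms with free parameter, so that all estimates add up to one pointwise majorant.

  The lower bound tests with densities proportional to \<open>1 + \<lambda> u\<^sup>\<beta>\<^sup>-\<^sup>1\<close> on \<open>{r \<le> u \<le> n}\<close> and to \<open>1\<close>
  elsewhere, the extremal shape for Hoelder's inequality on the tail
  (\<open>admissible_constant_ge_one_sided_tail\<close>). The two tails of \<open>u\<close> are treated separately because
  their contributions to \<open>\<integral>u d\<nu>\<close> have opposite signs.
\<close>

section \<open>Elementary inequalities\<close>

text \<open>This form of Bernoulli's inequality, and its reverse below for exponents in \<open>[0, 1]\<close>, are Young's
  inequality for the product of a power of \<open>x\<close> with \<open>1\<close>.\<close>

lemma powr_ge_tangent:
  fixes x a :: real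
  assumes "0 \<le> x" "1 \<le> a"
  shows "1 + a * (x - 1) \<le> x powr a"
proof (cases "a = 1 \<or> x = 0")
  case True
  then show ?thesis using assms by auto
next
  case False
  have "1 / (a / (a - 1)) = 1 - 1 / a" using False assms by (simp add: field_simps)
  then have "x * 1 \<le> x powr a / a + 1 powr (a / (a - 1)) / (a / (a - 1))"
    using False assms by (intro Youngs_inequality) (auto simp: field_simps)
  also have "\<dots> = (x powr a + a - 1) / a" using False assms by (simp add: field_simps)
  finally have "x * a \<le> x powr a + a - 1" using False assms by (simp add: pos_le_divide_eq)
  then show ?thesis by (simp add: algebra_simps)
qed

lemma powr_le_tangent:
  fixes x s :: real
  assumes "0 \<le> x" "0 \<le> s" "s \<le> 1"
  shows "x powr s \<le> 1 + s * (x - 1)"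
proof (cases "x = 0")
  case True
  then show ?thesis using assms by auto
next
  case False
  then show ?thesis
    using Youngs_inequality_0[of s "1 - s" x 1] assms by (simp add: algebra_simps)
qed

text \<open>The second derivative of \<open>x ln x\<close> is \<open>1/x\<close>, hence at least \<open>1/2\<close> up to \<open>x = 2\<close>.\<close>

lemma entropy_ge_quadratic:
  fixes x :: real
  assumes "0 < x" "x \<le> 2"
  shows "(x - 1)\<^sup>2 / 4 \<le> x * ln x - x + 1"
proof -
  define g where "g = (\<lambda>x::real. x * ln x - x + 1 - (x - 1)\<^sup>2 / 4)"
  have deriv: "(g has_real_derivative ln y - (y - 1) / 2) (at y)" if "0 < y" for y
    unfolding g_def using that by (auto intro!: derivative_eq_intros simp: field_simps)
  have "g 1 \<le> g x"
  proof (cases "1 \<le> x")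
    case True
    have "\<exists>d. DERIV g y :> d \<and> 0 \<le> d" if "1 \<le> y" "y \<le> x" for y
    proof -
      have "ln (1 / y) \<le> 1 / y - 1" using that by (intro ln_le_minus_one) auto
      then have "1 - 1 / y \<le> ln y" using that by (simp add: ln_div)
      moreover have "(y - 1) / 2 \<le> 1 - 1 / y"
      proof -
        have "0 \<le> (y - 1) * (2 - y)" using that assms by auto
        then show ?thesis using that by (simp add: field_simps)
      qed
      ultimately show ?thesis using deriv[of y] that by auto
    qed
    then show ?thesis using True DERIV_nonneg_imp_nondecreasing by blast
  next
    case False
    have "\<exists>d. DERIV g y :> d \<and> d \<le> 0" if "x \<le> y" "y \<le> 1" for y
    proof -
      have "ln y \<le> y - 1" using that assms by (intro ln_le_minus_one) auto
      then show ?thesis using deriv[of y] that assms by (auto simp: field_simps)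
    qed
    then show ?thesis using False DERIV_nonpos_imp_nonincreasing[of x 1 g] by auto
  qed
  then show ?thesis by (simp add: g_def)
qed

text \<open>Since \<open>x\<^sup>\<alpha>\<^sup>-\<^sup>1 \<ge> 1 + (\<alpha> - 1) ln x\<close>, the Bregman remainder of \<open>x\<^sup>\<alpha>\<close> at \<open>1\<close> dominates
  \<open>\<alpha> - 1\<close> times that of \<open>x ln x\<close>. The factor \<open>\<alpha> - 1\<close> splits off, so the constant is uniform
  as \<open>\<alpha> \<rightarrow> 1\<close>.\<close>

lemma bregman_ge_quadratic:
  fixes x \<alpha> :: real
  assumes "0 \<le> x" "x \<le> 2" "1 < \<alpha>" "\<alpha> \<le> 2"
  shows "(\<alpha> - 1) * (x - 1)\<^sup>2 / 4 \<le> x powr \<alpha> - 1 - \<alpha> * (x - 1)"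
proof (cases "x = 0")
  case True
  then show ?thesis using assms by auto
next
  case False
  then have x: "0 < x" using assms by auto
  have "x * (1 + (\<alpha> - 1) * ln x) \<le> x * exp ((\<alpha> - 1) * ln x)"
    using x by (intro mult_left_mono exp_ge_add_one_self) auto
  also have "\<dots> = x powr \<alpha>"
    using x by (simp add: powr_def algebra_simps exp_diff)
  finally have "(\<alpha> - 1) * (x * ln x - x + 1) \<le> x powr \<alpha> - 1 - \<alpha> * (x - 1)"
    by (simp add: algebra_simps)
  moreover have "(\<alpha> - 1) * ((x - 1)\<^sup>2 / 4) \<le> (\<alpha> - 1) * (x * ln x - x + 1)"
    using entropy_ge_quadratic[OF x] assms by (intro mult_left_mono) auto
  ultimately show ?thesis by (simp add: algebra_simps)
qed

text \<open>After moving the left-hand side across, a multiple of the convex function \<open>x\<^sup>\<alpha>\<close> has to dominate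
  a linear function for \<open>x \<ge> 2\<close>. Replacing \<open>x\<^sup>\<alpha>\<close> by its tangent at \<open>2\<close> reduces this to the value
  and the slope at \<open>2\<close>, that is, to a lower bound on \<open>2\<^sup>\<alpha>\<^sup>-\<^sup>1\<close>. The constant \<open>1/6\<close> leaves little
  slack, so \<open>exp\<close> is expanded to second order there.\<close>

lemma bregman_ge_powr:
  fixes x \<alpha> :: real
  assumes "2 \<le> x" "1 < \<alpha>" "\<alpha> \<le> 2"
  shows "(\<alpha> - 1) * x powr \<alpha> / 6 \<le> x powr \<alpha> - 1 - \<alpha> * (x - 1)"
proof -
  define s q y where "s = \<alpha> - 1" and "q = 2 powr s" and "y = x / 2"
  have s: "0 < s" "s \<le> 1" using assms by (auto simp: s_def)
  have y: "1 \<le> y" using assms by (simp add: y_def)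
  have "1 + (2 / 3 * s) + (2 / 3 * s)\<^sup>2 / 2 \<le> exp (2 / 3 * s)"
    using s by (intro exp_lower_Taylor_quadratic) auto
  also have "\<dots> \<le> q"
    using ln2_ge_two_thirds s by (simp add: q_def powr_def)
  finally have q: "1 + 2 / 3 * s + 2 / 9 * s\<^sup>2 \<le> q" by (simp add: power2_eq_square)
  have "(1 - s / 6) * (1 + 2 / 3 * s + 2 / 9 * s\<^sup>2) \<le> (1 - s / 6) * q"
    using q s by (intro mult_left_mono) auto
  moreover have "1 + s / 2 \<le> (1 - s / 6) * (1 + 2 / 3 * s + 2 / 9 * s\<^sup>2)"
  proof -
    have "s * s * s \<le> s * s" using s mult_left_mono[of s 1 "s * s"] by auto
    moreover have "(1 - s / 6) * (1 + 2 / 3 * s + 2 / 9 * s\<^sup>2) = 1 + s / 2 + s * s / 9 - s * s * s / 27"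
      by (simp add: field_simps power2_eq_square)
    moreover have "0 \<le> s * s" by auto
    ultimately show ?thesis by linarith
  qed
  ultimately have q': "1 + s / 2 \<le> (1 - s / 6) * q" by linarith
  have "x powr \<alpha> = 2 * q * y powr \<alpha>"
    using assms by (simp add: q_def s_def y_def powr_divide powr_diff)
  moreover have "1 + \<alpha> * (y - 1) \<le> y powr \<alpha>"
    using powr_ge_tangent[of y \<alpha>] y assms by auto
  ultimately have upper: "(1 - s / 6) * (2 * q * (1 + \<alpha> * (y - 1))) \<le> (1 - s / 6) * x powr \<alpha>"
    using s by (auto intro!: mult_left_mono simp: q_def)
  have "2 * (1 + s / 2) * (1 + \<alpha> * (y - 1)) - (1 + \<alpha> * (x - 1)) = s * \<alpha> * (y - 1)"
    by (simp add: y_def s_def field_simps)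
  moreover have "0 \<le> s * \<alpha> * (y - 1)" using s y assms by auto
  ultimately have "1 + \<alpha> * (x - 1) \<le> 2 * (1 + s / 2) * (1 + \<alpha> * (y - 1))" by linarith
  also have "\<dots> \<le> 2 * ((1 - s / 6) * q) * (1 + \<alpha> * (y - 1))"
    using q' y assms by (intro mult_right_mono mult_left_mono) auto
  also have "\<dots> = (1 - s / 6) * (2 * q * (1 + \<alpha> * (y - 1)))" by (simp only: mult_ac)
  also note upper
  finally have "1 + \<alpha> * (x - 1) \<le> (1 - s / 6) * x powr \<alpha>" .
  then show ?thesis by (simp add: s_def algebra_simps)
qed

text \<open>Expanding \<open>(1 + x)(1 + x)\<^sup>\<alpha>\<^sup>-\<^sup>1\<close> with Bernoulli settles \<open>x \<le> 1\<close>, even with the smaller \<open>x\<close>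
  in place of \<open>x\<^sup>\<alpha>\<^sup>-\<^sup>1\<close> in the middle term. The version with \<open>x\<^sup>\<alpha>\<^sup>-\<^sup>1\<close> is the one that turns into
  the claim for \<open>g \<ge> 1\<close> on substituting \<open>x = 1/g\<close> and multiplying by \<open>g\<^sup>\<alpha>\<close>.\<close>

lemma one_plus_powr_le:
  fixes g \<alpha> :: real
  assumes "0 \<le> g" "1 < \<alpha>" "\<alpha> \<le> 2"
  shows "(1 + g) powr \<alpha> \<le> 1 + \<alpha> * g + g powr \<alpha>"
proof -
  have small: "(1 + x) powr \<alpha> \<le> 1 + \<alpha> * x + x powr \<alpha>"
       "(1 + x) powr \<alpha> \<le> 1 + \<alpha> * x powr (\<alpha> - 1) + x powr \<alpha>"
    if "0 < x" "x \<le> 1" for x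
  proof -
    have "(1 + x) powr \<alpha> = (1 + x) * (1 + x) powr (\<alpha> - 1)"
      using that by (simp add: powr_diff)
    also have "\<dots> \<le> (1 + x) * (1 + (\<alpha> - 1) * x)"
      using powr_le_tangent[of "1 + x" "\<alpha> - 1"] that assms by (intro mult_left_mono) auto
    also have "\<dots> = 1 + \<alpha> * x + (\<alpha> - 1) * x\<^sup>2"
      by (simp add: algebra_simps power2_eq_square)
    also have "(\<alpha> - 1) * x\<^sup>2 \<le> 1 * x powr \<alpha>"
    proof (rule mult_mono)
      have "x powr 2 \<le> x powr \<alpha>" using that assms by (intro powr_mono') auto
      then show "x\<^sup>2 \<le> x powr \<alpha>" using that by simp
    qed (use assms in auto)
    finally show *: "(1 + x) powr \<alpha> \<le> 1 + \<alpha> * x + x powr \<alpha>" by simp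
    have "x powr 1 \<le> x powr (\<alpha> - 1)" using that assms by (intro powr_mono') auto
    then have "\<alpha> * x \<le> \<alpha> * x powr (\<alpha> - 1)"
      using that assms by (intro mult_left_mono) auto
    with * show "(1 + x) powr \<alpha> \<le> 1 + \<alpha> * x powr (\<alpha> - 1) + x powr \<alpha>" by simp
  qed
  consider "g = 0" | "0 < g" "g \<le> 1" | "1 < g" using assms by linarith
  then show ?thesis
  proof cases
    case 3
    define x where "x = 1 / g"
    have x: "0 < x" "x \<le> 1" using 3 by (auto simp: x_def)
    have "(1 + g) powr \<alpha> = g powr \<alpha> * (1 + x) powr \<alpha>"
      using 3 by (simp add: x_def powr_mult[symmetric] algebra_simps)
    also have "\<dots> \<le> g powr \<alpha> * (1 + \<alpha> * x powr (\<alpha> - 1) + x powr \<alpha>)"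
      using small(2)[OF x] by (intro mult_left_mono) auto
    also have "\<dots> = g powr \<alpha> + \<alpha> * g + 1"
      using 3 by (simp add: x_def powr_divide powr_diff field_simps)
    finally show ?thesis by simp
  qed (use small in auto)
qed

text \<open>Taylor's theorem; for \<open>\<alpha> \<ge> 2\<close> the second derivative increases, hence is largest at \<open>\<delta>\<close>.\<close>

lemma one_plus_powr_le_taylor:
  fixes h \<delta> \<alpha> :: real
  assumes "\<bar>h\<bar> \<le> \<delta>" "\<delta> < 1" "2 \<le> \<alpha>"
  shows "(1 + h) powr \<alpha> \<le> 1 + \<alpha> * h + \<alpha> * (\<alpha> - 1) / 2 * (1 + \<delta>) powr (\<alpha> - 2) * h\<^sup>2"
proof -
  define diff :: "nat \<Rightarrow> real \<Rightarrow> real" where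
    "diff = (\<lambda>m t. if m = 0 then (1 + t) powr \<alpha> else if m = 1 then \<alpha> * (1 + t) powr (\<alpha> - 1)
               else \<alpha> * (\<alpha> - 1) * (1 + t) powr (\<alpha> - 2))"
  have "\<forall>m t. m < 2 \<and> \<bar>t\<bar> \<le> \<bar>h\<bar> \<longrightarrow> DERIV (diff m) t :> diff (Suc m) t"
  proof (intro allI impI)
    fix m :: nat and t :: real
    assume "m < 2 \<and> \<bar>t\<bar> \<le> \<bar>h\<bar>"
    then have "m = 0 \<or> m = 1" "0 < 1 + t" using assms by auto
    then show "DERIV (diff m) t :> diff (Suc m) t"
      by (auto simp: diff_def intro!: derivative_eq_intros)
  qed
  then obtain t where t: "\<bar>t\<bar> \<le> \<bar>h\<bar>"
    and eq: "(1 + h) powr \<alpha> = (\<Sum>m<2. diff m 0 / fact m * h ^ m) + diff 2 t / fact 2 * h ^ 2"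
    using Maclaurin_bi_le[of diff "\<lambda>h. (1 + h) powr \<alpha>" 2 h] by (auto simp: diff_def)
  have "(1 + t) powr (\<alpha> - 2) \<le> (1 + \<delta>) powr (\<alpha> - 2)"
    using t assms by (intro powr_mono2) auto
  then have "\<alpha> * (\<alpha> - 1) / 2 * (1 + t) powr (\<alpha> - 2) * h\<^sup>2
      \<le> \<alpha> * (\<alpha> - 1) / 2 * (1 + \<delta>) powr (\<alpha> - 2) * h\<^sup>2"
    using assms by (intro mult_right_mono mult_left_mono) auto
  then show ?thesis
    using eq by (simp add: diff_def numeral_2_eq_2)
qed

section \<open>Constants in terms of densities\<close>

text \<open>The densities with respect to \<open>M\<close> of the measures of finite divergence. They are
  nonnegative everywhere, as are the versions of derivatives that \<^const>\<open>enn2real\<close> provides.\<close>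

definition prob_density :: "real \<Rightarrow> 'a measure \<Rightarrow> ('a \<Rightarrow> real) \<Rightarrow> bool" where
  "prob_density \<alpha> M f \<longleftrightarrow>
     f \<in> borel_measurable M \<and> (\<forall>x. 0 \<le> f x) \<and>
     integrable M f \<and> (\<integral>x. f x \<partial>M) = 1 \<and> integrable M (\<lambda>x. f x powr \<alpha>)"

text \<open>The defining derivative is almost everywhere equal to the given density.\<close>

lemma tsallis_density:
  assumes M: "prob_space M" and f: "prob_density \<alpha> M f"
  shows "tsallis \<alpha> (density M (\<lambda>x. ennreal (f x))) M
         = ereal (((\<integral>x. f x powr \<alpha> \<partial>M) - 1) / (\<alpha> - 1))"
proof -
  interpret prob_space M by fact
  have [measurable]: "f \<in> borel_measurable M" and nn: "\<And>x. 0 \<le> f x"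
    and int: "integrable M (\<lambda>x. f x powr \<alpha>)"
    using f by (auto simp: prob_density_def)
  let ?N = "density M (\<lambda>x. ennreal (f x))"
  have "AE x in M. ennreal (f x) = RN_deriv M ?N x"
    by (rule RN_deriv_unique) auto
  then have "AE x in M. ennreal (enn2real (RN_deriv M ?N x) powr \<alpha>) = ennreal (f x powr \<alpha>)"
    by eventually_elim (metis enn2real_ennreal nn)
  then have "(\<integral>\<^sup>+ x. ennreal (enn2real (RN_deriv M ?N x) powr \<alpha>) \<partial>M) = (\<integral>\<^sup>+ x. ennreal (f x powr \<alpha>) \<partial>M)"
    by (rule nn_integral_cong_AE)
  also have "\<dots> = ennreal (\<integral>x. f x powr \<alpha> \<partial>M)"
    using int by (intro nn_integral_eq_integral) auto
  finally show ?thesis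
    unfolding tsallis_def
    by (simp add: enn2ereal_ennreal one_ereal_def)
qed

text \<open>By the Radon-Nikodym theorem the measures in \<^const>\<open>admissible_constant\<close> are exactly those given
  by densities, and finiteness of the divergence is integrability of \<open>f\<^sup>\<alpha>\<close>.\<close>

lemma admissible_constant_iff_density:
  assumes M: "prob_space M" and "1 < \<alpha>" and u[measurable]: "u \<in> borel_measurable M"
  shows "admissible_constant \<alpha> M u c \<longleftrightarrow>
    0 \<le> c \<and>
    (\<forall>f. prob_density \<alpha> M f \<longrightarrow> integrable M (\<lambda>x. f x * u x) \<longrightarrow>
       \<bar>\<integral>x. f x * u x \<partial>M\<bar> \<le> c * sqrt (((\<integral>x. f x powr \<alpha> \<partial>M) - 1) / (\<alpha> - 1)))"
    (is "_ \<longleftrightarrow> 0 \<le> c \<and> ?dens")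
proof -
  interpret prob_space M by fact
  have "?dens" if adm: "admissible_constant \<alpha> M u c"
  proof (intro allI impI)
    fix f assume f: "prob_density \<alpha> M f" and fu: "integrable M (\<lambda>x. f x * u x)"
    have [measurable]: "f \<in> borel_measurable M" and nn: "\<And>x. 0 \<le> f x"
      and f_int: "integrable M f" "(\<integral>x. f x \<partial>M) = 1"
      using f by (auto simp: prob_density_def)
    let ?N = "density M (\<lambda>x. ennreal (f x))"
    have "(\<integral>\<^sup>+ x. ennreal (f x) \<partial>M) = 1"
      using nn_integral_eq_integral[OF f_int(1)] nn f_int(2) by auto
    then have "prob_space ?N"
      by (intro prob_spaceI) (simp add: emeasure_density cong: nn_integral_cong)
    moreover have "absolutely_continuous M ?N"
      by (rule absolutely_continuousI_density) auto
    moreover have "integrable ?N u"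
      using fu nn by (subst integrable_density) auto
    ultimately have "\<bar>\<integral>x. u x \<partial>?N\<bar> \<le> c * sqrt (real_of_ereal (tsallis \<alpha> ?N M))"
      using adm by (auto simp: admissible_constant_def tsallis_density[OF M f])
    then show "\<bar>\<integral>x. f x * u x \<partial>M\<bar> \<le> c * sqrt (((\<integral>x. f x powr \<alpha> \<partial>M) - 1) / (\<alpha> - 1))"
      using nn by (simp add: tsallis_density[OF M f] integral_density)
  qed
  moreover have "admissible_constant \<alpha> M u c" if "0 \<le> c" and dens: "?dens"
    unfolding admissible_constant_def
  proof (intro conjI allI impI)
    fix N assume N: "prob_space N" "sets N = sets M" "absolutely_continuous M N"
      and uN: "integrable N u" and fin: "tsallis \<alpha> N M < \<infinity>"
    interpret N: prob_space N by fact
    define f where "f = (\<lambda>x. enn2real (RN_deriv M N x))"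
    have [measurable]: "f \<in> borel_measurable M" and nn: "\<And>x. 0 \<le> f x" by (auto simp: f_def)
    have "AE x in M. RN_deriv M N x \<noteq> \<infinity>"
      using N by (intro RN_deriv_finite) (auto intro: N.sigma_finite_measure_axioms)
    then have "AE x in M. RN_deriv M N x = ennreal (f x)"
      by eventually_elim (simp add: f_def ennreal_enn2real_if)
    then have "density M (RN_deriv M N) = density M (\<lambda>x. ennreal (f x))"
      by (intro density_cong) auto
    then have N_eq: "N = density M (\<lambda>x. ennreal (f x))"
      using density_RN_deriv N by auto
    have "(\<integral>\<^sup>+ x. ennreal (f x) \<partial>M) = emeasure N (space M)"
      by (simp add: N_eq emeasure_density cong: nn_integral_cong)
    also have "\<dots> = 1"
      using N.emeasure_space_1 sets_eq_imp_space_eq[OF N(2)] by simp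
    finally have f_nn: "(\<integral>\<^sup>+ x. ennreal (f x) \<partial>M) = ennreal 1" by simp
    have f_int: "integrable M f"
      using f_nn nn by (intro integrableI_nonneg) auto
    have f_1: "(\<integral>x. f x \<partial>M) = 1"
      using f_nn nn by (intro integral_eq_nn_integral[THEN trans]) auto
    have "(\<integral>\<^sup>+ x. ennreal (f x powr \<alpha>) \<partial>M) < \<infinity>"
    proof (rule ccontr)
      assume "\<not> ?thesis"
      then have "(\<integral>\<^sup>+ x. ennreal (enn2real (RN_deriv M N x) powr \<alpha>) \<partial>M) = \<infinity>"
        by (simp add: f_def less_top[symmetric])
      then have "tsallis \<alpha> N M = \<infinity>"
        using assms by (simp add: tsallis_def)
      then show False using fin by simp
    qed
    then have "integrable M (\<lambda>x. f x powr \<alpha>)" by (intro integrableI_nonneg) auto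
    then have f: "prob_density \<alpha> M f"
      using f_int f_1 nn by (auto simp: prob_density_def)
    have "integrable M (\<lambda>x. f x * u x)"
      using uN nn unfolding N_eq by (subst (asm) integrable_density) auto
    with dens f have "\<bar>\<integral>x. f x * u x \<partial>M\<bar> \<le> c * sqrt (((\<integral>x. f x powr \<alpha> \<partial>M) - 1) / (\<alpha> - 1))"
      by blast
    then show "\<bar>\<integral>x. u x \<partial>N\<bar> \<le> c * sqrt (real_of_ereal (tsallis \<alpha> N M))"
      using nn unfolding N_eq by (simp add: tsallis_density[OF M f] integral_density)
  qed fact
  ultimately show ?thesis by (auto simp: admissible_constant_def)
qed

lemma admissible_constantD:
  assumes "admissible_constant \<alpha> M u c" "prob_space M" "1 < \<alpha>" "u \<in> borel_measurable M"
    and "prob_density \<alpha> M f" "integrable M (\<lambda>x. f x * u x)"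
  shows "\<bar>\<integral>x. f x * u x \<partial>M\<bar> \<le> c * sqrt (((\<integral>x. f x powr \<alpha> \<partial>M) - 1) / (\<alpha> - 1))"
  using admissible_constant_iff_density[OF assms(2-4)] assms(1,5,6) by blast

lemma ennreal_pow_le_iff:
  assumes "0 < a" "0 \<le> k"
  shows "ennreal_pow x (1 / a) \<le> ennreal k \<longleftrightarrow> x \<le> ennreal (k powr a)"
proof (cases x)
  case (real r)
  have "r powr (1 / a) \<le> k \<longleftrightarrow> r \<le> k powr a"
  proof
    assume "r powr (1 / a) \<le> k"
    then have "(r powr (1 / a)) powr a \<le> k powr a" using assms by (intro powr_mono2) auto
    then show "r \<le> k powr a" using assms real by (simp add: powr_powr)
  next
    assume "r \<le> k powr a"
    then have "r powr (1 / a) \<le> (k powr a) powr (1 / a)"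
      using assms real by (intro powr_mono2) auto
    then show "r powr (1 / a) \<le> k" using assms by (simp add: powr_powr)
  qed
  then show ?thesis using real assms by (simp add: ennreal_pow_def)
qed (use assms in \<open>simp_all add: ennreal_pow_def top_unique\<close>)

lemma K_const_le_iff:
  assumes "1 < p" "0 \<le> k"
  shows "K_const p M u \<le> ennreal k \<longleftrightarrow>
    (\<forall>r>0. ennreal (r powr (p - 2)) *
       (\<integral>\<^sup>+ x\<in>{x \<in> space M. r \<le> \<bar>u x\<bar>}. ennreal (\<bar>u x\<bar> powr p) \<partial>M) \<le> ennreal (k powr (2 * p - 2)))"
  unfolding K_const_def using assms by (subst ennreal_pow_le_iff) (auto simp: SUP_le_iff)

lemma L2_norm_le_iff:
  assumes "0 \<le> k"
  shows "L2_norm M u \<le> ennreal k \<longleftrightarrow> (\<integral>\<^sup>+ x. ennreal ((u x)\<^sup>2) \<partial>M) \<le> ennreal (k\<^sup>2)"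
  unfolding L2_norm_def using assms by (subst ennreal_pow_le_iff) auto

text \<open>Restricting to \<open>k > 0\<close> lets the proofs below divide by \<open>k\<close>; the case \<open>X = 0\<close> is recovered
  by letting \<open>k\<close> tend to \<open>0\<close>.\<close>

lemma best_constant_le:
  assumes "0 < C" and "\<And>k. 0 < k \<Longrightarrow> X \<le> ennreal k \<Longrightarrow> admissible_constant \<alpha> M u (C * k)"
  shows "best_constant \<alpha> M u \<le> ennreal C * X"
proof (rule ennreal_le_epsilon)
  fix e :: real
  assume fin: "ennreal C * X < top" and e: "0 < e"
  then obtain x where x: "X = ennreal x" "0 \<le> x"
    using assms by (cases X) (auto simp: ennreal_mult_top)
  have "admissible_constant \<alpha> M u (C * (x + e / C))"
    using assms(1) e x by (intro assms(2)) (auto intro!: add_nonneg_pos)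
  then have "best_constant \<alpha> M u \<le> ennreal (C * (x + e / C))"
    unfolding best_constant_def by (intro Inf_lower) auto
  also have "\<dots> = ennreal C * X + ennreal e"
    using assms e x by (simp add: distrib_left ennreal_mult)
  finally show "best_constant \<alpha> M u \<le> ennreal C * X + ennreal e" .
qed

lemma best_constant_ge:
  assumes "\<And>c. admissible_constant \<alpha> M u c \<Longrightarrow> X \<le> ennreal c"
  shows "X \<le> best_constant \<alpha> M u"
  unfolding best_constant_def using assms by (auto intro: Inf_greatest)

section \<open>Upper bounds\<close>

text \<open>Working with any \<open>t > 0\<close> such that \<open>T \<le> t\<^sup>2\<close>, instead of \<open>t = \<surd>T\<close>, allows division by \<open>t\<close> and
  covers \<open>T = 0\<close> by a limit.\<close>

lemma admissible_constantI:
  assumes M: "prob_space M" and \<alpha>: "1 < \<alpha>" and u: "u \<in> borel_measurable M" and c: "0 \<le> c"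
    and bound: "\<And>f t. prob_density \<alpha> M f \<Longrightarrow> integrable M (\<lambda>x. f x * u x) \<Longrightarrow> 0 < t \<Longrightarrow>
        ((\<integral>x. f x powr \<alpha> \<partial>M) - 1) / (\<alpha> - 1) \<le> t\<^sup>2 \<Longrightarrow> \<bar>\<integral>x. f x * u x \<partial>M\<bar> \<le> c * t"
  shows "admissible_constant \<alpha> M u c"
  unfolding admissible_constant_iff_density[OF M \<alpha> u]
proof (intro conjI allI impI)
  interpret prob_space M by fact
  fix f assume f: "prob_density \<alpha> M f" and fu: "integrable M (\<lambda>x. f x * u x)"
  define T where "T = ((\<integral>x. f x powr \<alpha> \<partial>M) - 1) / (\<alpha> - 1)"
  have f': "\<And>x. 0 \<le> f x" "integrable M f" "(\<integral>x. f x \<partial>M) = 1" "integrable M (\<lambda>x. f x powr \<alpha>)"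
    using f by (auto simp: prob_density_def)
  have "(\<integral>x. 1 + \<alpha> * (f x - 1) \<partial>M) \<le> (\<integral>x. f x powr \<alpha> \<partial>M)"
    using f' \<alpha> by (intro integral_mono powr_ge_tangent) auto
  then have T: "0 \<le> T" using f' \<alpha> by (simp add: T_def prob_space)
  have "\<bar>\<integral>x. f x * u x \<partial>M\<bar> \<le> c * (sqrt T + e)" if "0 < e" for e
  proof (rule bound[OF f fu])
    show "0 < sqrt T + e" using T that by (simp add: add_nonneg_pos)
    have "(sqrt T)\<^sup>2 \<le> (sqrt T + e)\<^sup>2" using T that by (intro power_mono) auto
    then show "((\<integral>x. f x powr \<alpha> \<partial>M) - 1) / (\<alpha> - 1) \<le> (sqrt T + e)\<^sup>2"
      using T by (simp add: T_def)
  qed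
  then have "\<forall>\<^sub>F e in at_right 0. \<bar>\<integral>x. f x * u x \<partial>M\<bar> \<le> c * (sqrt T + e)"
    by (auto simp: eventually_at_filter)
  moreover have "((\<lambda>e. c * (sqrt T + e)) \<longlongrightarrow> c * (sqrt T + 0)) (at_right 0)"
    by (intro tendsto_intros)
  ultimately have "\<bar>\<integral>x. f x * u x \<partial>M\<bar> \<le> c * (sqrt T + 0)"
    by (intro tendsto_lowerbound) auto
  then show "\<bar>\<integral>x. f x * u x \<partial>M\<bar> \<le> c * sqrt (((\<integral>x. f x powr \<alpha> \<partial>M) - 1) / (\<alpha> - 1))"
    by (simp add: T_def)
qed fact

text \<open>As \<open>u\<close> is centred, only \<open>f - 1\<close> matters, and a pointwise majorant of \<open>\<bar>f - 1\<bar> \<bar>u\<bar>\<close> suffices.\<close>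

lemma integral_density_centred:
  fixes u :: "'a \<Rightarrow> real"
  assumes "integrable M u" "(\<integral>x. u x \<partial>M) = 0" "integrable M (\<lambda>x. f x * u x)"
    and "integrable M F" and "\<And>x. x \<in> space M \<Longrightarrow> \<bar>f x - 1\<bar> * \<bar>u x\<bar> \<le> F x"
  shows "\<bar>\<integral>x. f x * u x \<partial>M\<bar> \<le> (\<integral>x. F x \<partial>M)"
proof -
  have int: "integrable M (\<lambda>x. f x * u x - u x)" using assms by auto
  have "(\<integral>x. f x * u x \<partial>M) = (\<integral>x. f x * u x - u x \<partial>M)"
    using assms by simp
  also have "\<bar>\<dots>\<bar> \<le> (\<integral>x. \<bar>f x * u x - u x\<bar> \<partial>M)" by (rule integral_abs_bound)
  also have "\<dots> \<le> (\<integral>x. F x \<partial>M)"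
  proof (rule integral_mono)
    fix x assume "x \<in> space M"
    then show "\<bar>f x * u x - u x\<bar> \<le> F x"
      using assms(5)[of x] by (simp add: left_diff_distrib flip: abs_mult)
  qed (use int assms in auto)
  finally show ?thesis .
qed

text \<open>The pointwise form of Cauchy-Schwarz; the optimal \<open>a\<close> is the ratio of the two norms.\<close>

lemma abs_mult_le_weighted_squares:
  fixes x y a :: real
  assumes "0 < a"
  shows "\<bar>x\<bar> * \<bar>y\<bar> \<le> a / 2 * y\<^sup>2 + x\<^sup>2 / (2 * a)"
proof -
  have "0 \<le> (\<bar>x\<bar> - a * \<bar>y\<bar>)\<^sup>2 / (2 * a)" using assms by auto
  also have "\<dots> = a / 2 * y\<^sup>2 + x\<^sup>2 / (2 * a) - \<bar>x\<bar> * \<bar>y\<bar>"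
    using assms by (simp add: power2_diff field_simps power_mult_distrib) (simp add: power2_eq_square)
  finally show ?thesis by simp
qed

text \<open>The function \<open>B\<close> below has integral \<open>T\<^sub>\<alpha>\<close> and dominates \<open>(f - 1)\<^sup>2\<close> by Bernoulli's inequality
  for the exponent \<open>\<alpha> - 1 \<ge> 1\<close>.\<close>

lemma admissible_constant_L2:
  assumes M: "prob_space M" and \<alpha>: "2 \<le> \<alpha>" and u: "integrable M u" "(\<integral>x. u x \<partial>M) = 0"
    and k: "0 < k" and L2: "(\<integral>\<^sup>+ x. ennreal ((u x)\<^sup>2) \<partial>M) \<le> ennreal (k\<^sup>2)"
  shows "admissible_constant \<alpha> M u k"
proof (rule admissible_constantI)
  interpret prob_space M by fact
  show [measurable]: "u \<in> borel_measurable M" using u by auto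
  fix f :: "'a \<Rightarrow> real" and t :: real
  assume f: "prob_density \<alpha> M f" and fu: "integrable M (\<lambda>x. f x * u x)" and t: "0 < t"
    and T: "((\<integral>x. f x powr \<alpha> \<partial>M) - 1) / (\<alpha> - 1) \<le> t\<^sup>2"
  have f': "\<And>x. 0 \<le> f x" "integrable M f" "(\<integral>x. f x \<partial>M) = 1" "integrable M (\<lambda>x. f x powr \<alpha>)"
    using f by (auto simp: prob_density_def)
  have u2: "integrable M (\<lambda>x. (u x)\<^sup>2)"
    using L2 by (intro integrableI_nonneg) (auto simp: less_top[symmetric] top_unique)
  then have u2_le: "(\<integral>x. (u x)\<^sup>2 \<partial>M) \<le> k\<^sup>2"
    using L2 by (subst (asm) nn_integral_eq_integral) auto
  define a where "a = t / k"
  have a: "0 < a" using t k by (simp add: a_def)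
  define B where "B = (\<lambda>x. (f x powr \<alpha> - f x - (\<alpha> - 1) * (f x - 1)) / (\<alpha> - 1))"
  have B_int: "integrable M B" using f' by (auto simp: B_def)
  have B_le: "(\<integral>x. B x \<partial>M) \<le> t\<^sup>2" using T f' by (simp add: B_def prob_space)
  have B: "(f x - 1)\<^sup>2 \<le> B x" for x
  proof -
    have "f x * (1 + (\<alpha> - 1) * (f x - 1)) \<le> f x * f x powr (\<alpha> - 1)"
      using f' \<alpha> by (intro mult_left_mono powr_ge_tangent) auto
    also have "f x * f x powr (\<alpha> - 1) = f x powr \<alpha>"
      using f'(1)[of x] by (cases "f x = 0") (auto simp: powr_diff)
    finally show ?thesis
      using \<alpha> by (simp add: B_def pos_le_divide_eq) (simp add: algebra_simps power2_eq_square)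
  qed
  have "\<bar>\<integral>x. f x * u x \<partial>M\<bar> \<le> (\<integral>x. a / 2 * (u x)\<^sup>2 + B x / (2 * a) \<partial>M)"
  proof (rule integral_density_centred[OF u fu])
    fix x
    have "(f x - 1)\<^sup>2 / (2 * a) \<le> B x / (2 * a)" using B[of x] a by (intro divide_right_mono) auto
    then show "\<bar>f x - 1\<bar> * \<bar>u x\<bar> \<le> a / 2 * (u x)\<^sup>2 + B x / (2 * a)"
      using abs_mult_le_weighted_squares[OF a, of "f x - 1" "u x"] by linarith
  qed (use u2 B_int in auto)
  also have "\<dots> = a / 2 * (\<integral>x. (u x)\<^sup>2 \<partial>M) + (\<integral>x. B x \<partial>M) / (2 * a)"
    using u2 B_int by simp
  also have "\<dots> \<le> a / 2 * k\<^sup>2 + t\<^sup>2 / (2 * a)"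
    using u2_le B_le a by (intro add_mono mult_left_mono divide_right_mono) auto
  also have "\<dots> = k * t" using k t by (simp add: a_def field_simps power2_eq_square)
  finally show "\<bar>\<integral>x. f x * u x \<partial>M\<bar> \<le> k * t" .
qed (use assms in auto)

text \<open>The parameter \<open>a = t / k\<close> serves both as weight in Cauchy-Schwarz and, raised to \<open>1/\<alpha>\<close>, as
  scaling in Young's inequality; with \<open>r = k t\<close>, it makes every term of the majorant \<open>F\<close> integrate to at
  most a multiple of \<open>k t\<close>. These multiples add up to \<open>10 - 5/\<beta>\<close>, which stays below \<open>4 \<beta> \<le> 2 \<beta>\<^sup>2 \<le> 2 \<beta>\<^sup>\<beta>\<close>
  because \<open>\<beta> \<ge> 2\<close>.\<close>

lemma admissible_constant_K_const:
  fixes \<alpha> \<beta> :: real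
  assumes M: "prob_space M" and \<alpha>: "1 < \<alpha>" "\<alpha> \<le> 2" and \<beta>: "\<beta> = \<alpha> / (\<alpha> - 1)"
    and u: "integrable M u" "(\<integral>x. u x \<partial>M) = 0"
    and k: "0 < k" and K: "K_const \<beta> M u \<le> ennreal k"
  shows "admissible_constant \<alpha> M u (2 * \<beta> powr \<beta> * k)"
proof (rule admissible_constantI)
  interpret prob_space M by fact
  show [measurable]: "u \<in> borel_measurable M" using u by auto
  have \<beta>2: "2 \<le> \<beta>" using \<alpha> by (simp add: \<beta> pos_le_divide_eq)
  have conj: "1 / \<alpha> + 1 / \<beta> = 1" using \<alpha> by (simp add: \<beta> field_simps)
  define W where "W = (\<lambda>r x. \<bar>u x\<bar> powr \<beta> * indicator {x \<in> space M. r \<le> \<bar>u x\<bar>} x)"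
  have W: "integrable M (W r)" "(\<integral>x. W r x \<partial>M) \<le> k powr (2 * \<beta> - 2) * r powr (2 - \<beta>)" if "0 < r" for r
  proof -
    have "ennreal (r powr (\<beta> - 2)) * (\<integral>\<^sup>+ x\<in>{x \<in> space M. r \<le> \<bar>u x\<bar>}. ennreal (\<bar>u x\<bar> powr \<beta>) \<partial>M)
        = (\<integral>\<^sup>+ x. ennreal (r powr (\<beta> - 2) * W r x) \<partial>M)"
      by (subst nn_integral_cmult[symmetric])
         (auto intro!: nn_integral_cong simp: W_def ennreal_mult split: split_indicator)
    then have le: "(\<integral>\<^sup>+ x. ennreal (r powr (\<beta> - 2) * W r x) \<partial>M) \<le> ennreal (k powr (2 * \<beta> - 2))"
      using K that k \<beta>2 by (subst (asm) K_const_le_iff) auto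
    have "integrable M (\<lambda>x. r powr (\<beta> - 2) * W r x)"
    proof (rule integrableI_nonneg)
      show "(\<integral>\<^sup>+ x. ennreal (r powr (\<beta> - 2) * W r x) \<partial>M) < \<infinity>"
        using le by (auto simp: less_top[symmetric] top_unique)
    qed (auto simp: W_def)
    then have int: "integrable M (\<lambda>x. r powr (\<beta> - 2) * W r x)" .
    then show "integrable M (W r)" using that by simp
    have "r powr (\<beta> - 2) * (\<integral>x. W r x \<partial>M) \<le> k powr (2 * \<beta> - 2)"
      using le int by (subst (asm) nn_integral_eq_integral) (auto simp: W_def)
    then have "r powr (\<beta> - 2) * (\<integral>x. W r x \<partial>M) * r powr (2 - \<beta>)
        \<le> k powr (2 * \<beta> - 2) * r powr (2 - \<beta>)"
      by (intro mult_right_mono) auto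
    then have "(\<integral>x. W r x \<partial>M) * (r powr (\<beta> - 2) * r powr (2 - \<beta>))
        \<le> k powr (2 * \<beta> - 2) * r powr (2 - \<beta>)"
      by (simp only: mult_ac)
    moreover have "r powr (\<beta> - 2) * r powr (2 - \<beta>) = 1"
      using that by (simp flip: powr_add)
    ultimately show "(\<integral>x. W r x \<partial>M) \<le> k powr (2 * \<beta> - 2) * r powr (2 - \<beta>)"
      by simp
  qed
  \<comment> \<open>The tail at level \<open>k\<close> alone controls the second moment: \<open>\<bar>u\<bar> < k\<close> contributes at most \<open>k\<^sup>2\<close>,
    and \<open>\<bar>u\<bar> \<ge> k\<close> at most \<open>k\<^sup>2\<^sup>-\<^sup>\<beta>\<close> times the tail of \<open>\<bar>u\<bar>\<^sup>\<beta>\<close>, a product that is at most \<open>k\<^sup>2\<close> again.\<close>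
  have u2_pt: "(u x)\<^sup>2 \<le> k\<^sup>2 + k powr (2 - \<beta>) * W k x" if "x \<in> space M" for x
  proof (cases "\<bar>u x\<bar> < k")
    case True
    then have "\<bar>u x\<bar>\<^sup>2 \<le> k\<^sup>2" by (intro power_mono) auto
    then show ?thesis by (simp add: W_def add_increasing2)
  next
    case False
    have "\<bar>u x\<bar> powr (2 - \<beta>) \<le> k powr (2 - \<beta>)"
      using False k \<beta>2 by (intro powr_mono2') auto
    then have "\<bar>u x\<bar> powr (2 - \<beta>) * \<bar>u x\<bar> powr \<beta> \<le> k powr (2 - \<beta>) * \<bar>u x\<bar> powr \<beta>"
      by (intro mult_right_mono) auto
    moreover have "\<bar>u x\<bar> powr (2 - \<beta>) * \<bar>u x\<bar> powr \<beta> = (u x)\<^sup>2"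
      using False k by (simp flip: powr_add)
    ultimately show ?thesis using False that by (simp add: W_def add_increasing)
  qed
  have u2: "integrable M (\<lambda>x. (u x)\<^sup>2)"
  proof (rule Bochner_Integration.integrable_bound)
    show "integrable M (\<lambda>x. k\<^sup>2 + k powr (2 - \<beta>) * W k x)" using W(1)[OF k] by simp
    show "AE x in M. norm ((u x)\<^sup>2) \<le> norm (k\<^sup>2 + k powr (2 - \<beta>) * W k x)"
    proof (rule AE_I2)
      fix x assume "x \<in> space M"
      from u2_pt[OF this] show "norm ((u x)\<^sup>2) \<le> norm (k\<^sup>2 + k powr (2 - \<beta>) * W k x)"
        by simp
    qed
  qed simp
  have "(\<integral>x. (u x)\<^sup>2 \<partial>M) \<le> (\<integral>x. k\<^sup>2 + k powr (2 - \<beta>) * W k x \<partial>M)"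
    using W(1)[OF k] u2 by (intro integral_mono u2_pt) auto
  also have "\<dots> = k\<^sup>2 + k powr (2 - \<beta>) * (\<integral>x. W k x \<partial>M)"
    using W(1)[OF k] by (simp add: prob_space)
  also have "\<dots> \<le> k\<^sup>2 + k powr (2 - \<beta>) * (k powr (2 * \<beta> - 2) * k powr (2 - \<beta>))"
    using W(2)[OF k] by (intro add_left_mono mult_left_mono) auto
  also have "k powr (2 - \<beta>) * (k powr (2 * \<beta> - 2) * k powr (2 - \<beta>)) = k\<^sup>2"
    using k by (simp flip: powr_add)
  finally have u2_le: "(\<integral>x. (u x)\<^sup>2 \<partial>M) \<le> 2 * k\<^sup>2" by simp

  fix f :: "'a \<Rightarrow> real" and t :: real
  assume f: "prob_density \<alpha> M f" and fu: "integrable M (\<lambda>x. f x * u x)" and t: "0 < t"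
    and T: "((\<integral>x. f x powr \<alpha> \<partial>M) - 1) / (\<alpha> - 1) \<le> t\<^sup>2"
  have f': "\<And>x. 0 \<le> f x" "integrable M f" "(\<integral>x. f x \<partial>M) = 1" "integrable M (\<lambda>x. f x powr \<alpha>)"
    using f by (auto simp: prob_density_def)
  define a r where "a = t / k" and "r = k * t"
  have a: "0 < a" and r: "0 < r" using t k by (auto simp: a_def r_def)
  define B where "B = (\<lambda>x. (f x powr \<alpha> - 1 - \<alpha> * (f x - 1)) / (\<alpha> - 1))"
  have B_int: "integrable M B" using f' by (auto simp: B_def)
  have B_le: "(\<integral>x. B x \<partial>M) \<le> t\<^sup>2" using T f' by (simp add: B_def prob_space)
  have B_nn: "0 \<le> B x" for x
    using powr_ge_tangent[of "f x" \<alpha>] f'(1)[of x] \<alpha> by (simp add: B_def)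
  have B_small: "(f x - 1)\<^sup>2 \<le> 4 * B x" if "f x \<le> 2" for x
    using bregman_ge_quadratic[of "f x" \<alpha>] f'(1)[of x] \<alpha> that
    by (simp add: B_def field_simps)
  have B_large: "f x powr \<alpha> \<le> 6 * B x" if "2 < f x" for x
    using bregman_ge_powr[of "f x" \<alpha>] \<alpha> that by (simp add: B_def field_simps)
  define F where "F = (\<lambda>x. a / 2 * (u x)\<^sup>2 + 2 / a * B x + r * f x
      + a powr (\<beta> - 1) / \<beta> * W r x + 6 / (\<alpha> * a) * B x)"
  have "\<bar>\<integral>x. f x * u x \<partial>M\<bar> \<le> (\<integral>x. F x \<partial>M)"
  proof (rule integral_density_centred[OF u fu])
    fix x assume x: "x \<in> space M"
    have nn: "0 \<le> a / 2 * (u x)\<^sup>2" "0 \<le> 2 / a * B x" "0 \<le> r * f x"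
      "0 \<le> a powr (\<beta> - 1) / \<beta> * W r x" "0 \<le> 6 / (\<alpha> * a) * B x"
      using a r f'(1)[of x] B_nn[of x] \<alpha> \<beta>2 by (auto simp: W_def)
    consider "f x \<le> 2" | "2 < f x" "\<bar>u x\<bar> < r" | "2 < f x" "r \<le> \<bar>u x\<bar>" by linarith
    then show "\<bar>f x - 1\<bar> * \<bar>u x\<bar> \<le> F x"
    proof cases
      case 1
      have "(f x - 1)\<^sup>2 / (2 * a) \<le> 4 * B x / (2 * a)"
        using B_small[OF 1] a by (intro divide_right_mono) auto
      then have "(f x - 1)\<^sup>2 / (2 * a) \<le> 2 / a * B x" by simp
      then show ?thesis
        using abs_mult_le_weighted_squares[OF a, of "f x - 1" "u x"] nn unfolding F_def by linarith
    next
      case 2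
      have "\<bar>f x - 1\<bar> * \<bar>u x\<bar> \<le> f x * r" using 2 by (intro mult_mono) auto
      then show ?thesis using nn unfolding F_def by (simp add: mult.commute)
    next
      case 3
      have "\<bar>f x - 1\<bar> * \<bar>u x\<bar> \<le> f x * \<bar>u x\<bar>" using 3 by (intro mult_right_mono) auto
      also have "\<dots> = (a powr (1 / \<alpha>) * \<bar>u x\<bar>) * (f x * a powr (- (1 / \<alpha>)))"
        using a by (simp add: powr_minus)
      also have "\<dots> \<le> (a powr (1 / \<alpha>) * \<bar>u x\<bar>) powr \<beta> / \<beta> + (f x * a powr (- (1 / \<alpha>))) powr \<alpha> / \<alpha>"
        using \<alpha> \<beta>2 conj 3 by (intro Youngs_inequality) auto
      also have "(a powr (1 / \<alpha>) * \<bar>u x\<bar>) powr \<beta> = a powr (\<beta> - 1) * \<bar>u x\<bar> powr \<beta>"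
      proof -
        have "1 / \<alpha> * \<beta> = \<beta> - 1" using \<alpha> by (simp add: \<beta> field_simps)
        then show ?thesis using a by (simp add: powr_mult powr_powr)
      qed
      also have "(f x * a powr (- (1 / \<alpha>))) powr \<alpha> / \<alpha> = f x powr \<alpha> / (\<alpha> * a)"
      proof -
        have "(f x * a powr (- (1 / \<alpha>))) powr \<alpha> = f x powr \<alpha> * a powr (- 1)"
          using a \<alpha> 3 by (simp add: powr_mult powr_powr)
        also have "a powr (- 1) = 1 / a" using a by (simp add: powr_minus divide_inverse)
        finally show ?thesis by (simp add: mult.commute)
      qed
      also have "f x powr \<alpha> / (\<alpha> * a) \<le> 6 * B x / (\<alpha> * a)"
        using B_large[OF 3(1)] a \<alpha> by (intro divide_right_mono) auto
      finally have "\<bar>f x - 1\<bar> * \<bar>u x\<bar> \<le> a powr (\<beta> - 1) / \<beta> * W r x + 6 / (\<alpha> * a) * B x"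
        using 3 x by (simp add: W_def)
      then show ?thesis using nn unfolding F_def by linarith
    qed
  qed (use u2 B_int f' W(1)[OF r] in \<open>auto simp: F_def\<close>)
  also have "\<dots> = a / 2 * (\<integral>x. (u x)\<^sup>2 \<partial>M) + 2 / a * (\<integral>x. B x \<partial>M) + r
      + a powr (\<beta> - 1) / \<beta> * (\<integral>x. W r x \<partial>M) + 6 / (\<alpha> * a) * (\<integral>x. B x \<partial>M)"
    using u2 B_int f' W(1)[OF r] by (simp add: F_def)
  also have "\<dots> \<le> a / 2 * (2 * k\<^sup>2) + 2 / a * t\<^sup>2 + r
      + a powr (\<beta> - 1) / \<beta> * (k powr (2 * \<beta> - 2) * r powr (2 - \<beta>)) + 6 / (\<alpha> * a) * t\<^sup>2"
    using u2_le B_le W(2)[OF r] a \<alpha> \<beta>2 by (intro add_mono mult_left_mono) auto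
  also have "a powr (\<beta> - 1) / \<beta> * (k powr (2 * \<beta> - 2) * r powr (2 - \<beta>)) = k * t / \<beta>"
  proof -
    have "a powr (\<beta> - 1) * (k powr (2 * \<beta> - 2) * r powr (2 - \<beta>))
       = t powr (\<beta> - 1) * t powr (2 - \<beta>) * (k powr (1 - \<beta>) * k powr (2 * \<beta> - 2) * k powr (2 - \<beta>))"
    proof -
      have "k powr (1 - \<beta>) = inverse (k powr (\<beta> - 1))" using powr_minus[of k "\<beta> - 1"] by simp
      then have "a powr (\<beta> - 1) = t powr (\<beta> - 1) * k powr (1 - \<beta>)"
        using k t by (simp add: a_def powr_divide) (simp add: divide_inverse)
      then show ?thesis
        using k t by (simp add: r_def powr_mult mult_ac)
    qed
    also have "\<dots> = t * k" using k t by (simp flip: powr_add)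
    finally show ?thesis by (simp add: field_simps)
  qed
  also have "a / 2 * (2 * k\<^sup>2) + 2 / a * t\<^sup>2 + r + k * t / \<beta> + 6 / (\<alpha> * a) * t\<^sup>2
      = k * t * (4 + 1 / \<beta> + 6 * (1 / \<alpha>))"
    using k t \<alpha> \<beta>2 by (simp add: a_def r_def field_simps power2_eq_square)
  also have "\<dots> = k * t * (10 - 5 / \<beta>)"
  proof -
    have "1 / \<alpha> = 1 - 1 / \<beta>" using conj by simp
    then show ?thesis by simp
  qed
  also have "\<dots> \<le> k * t * (2 * \<beta> powr \<beta>)"
  proof (intro mult_left_mono)
    have "0 \<le> (\<beta> - 2) * (4 * \<beta> - 2)" using \<beta>2 by auto
    then have "10 - 5 / \<beta> \<le> 4 * \<beta>" using \<beta>2 by (simp add: field_simps)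
    also have "\<dots> \<le> 2 * (\<beta> * \<beta>)" using \<beta>2 by auto
    also have "\<beta> * \<beta> = \<beta> powr 2" using \<beta>2 by (simp add: power2_eq_square)
    also have "\<dots> \<le> \<beta> powr \<beta>" using \<beta>2 by (intro powr_mono) auto
    finally show "10 - 5 / \<beta> \<le> 2 * \<beta> powr \<beta>" by simp
  qed (use k t in auto)
  finally show "\<bar>\<integral>x. f x * u x \<partial>M\<bar> \<le> 2 * \<beta> powr \<beta> * k * t" by (simp add: mult_ac)
qed (use assms in auto)

section \<open>Lower bounds\<close>

lemma nn_integral_le_if_truncations_le:
  fixes u :: "'a \<Rightarrow> real"
  assumes [measurable]: "g \<in> borel_measurable M" "u \<in> borel_measurable M"
    and le: "\<And>n :: nat. (\<integral>\<^sup>+ x. g x * indicator {x \<in> space M. \<bar>u x\<bar> \<le> real n} x \<partial>M) \<le> B"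
  shows "(\<integral>\<^sup>+ x. g x \<partial>M) \<le> B"
proof -
  let ?g = "\<lambda>(n::nat) x. g x * indicator {x \<in> space M. \<bar>u x\<bar> \<le> real n} x"
  have "g x = (SUP n. ?g n x)" if "x \<in> space M" for x
  proof (rule antisym)
    obtain n :: nat where "\<bar>u x\<bar> \<le> real n" using real_arch_simple by blast
    then have "g x = ?g n x" using that by simp
    also have "\<dots> \<le> (SUP n. ?g n x)" by (rule SUP_upper) simp
    finally show "g x \<le> (SUP n. ?g n x)" .
  qed (auto intro!: SUP_least split: split_indicator)
  then have "(\<integral>\<^sup>+ x. g x \<partial>M) = (\<integral>\<^sup>+ x. (SUP n. ?g n x) \<partial>M)"
    by (rule nn_integral_cong)
  also have "\<dots> = (SUP n. integral\<^sup>N M (?g n))"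
    by (intro nn_integral_monotone_convergence_SUP)
       (auto simp: incseq_def le_fun_def split: split_indicator)
  also have "\<dots> \<le> B" using le by (intro SUP_least)
  finally show ?thesis .
qed

text \<open>Perturbing \<open>M\<close> by a small multiple of the centred truncation \<open>v = w - m\<close> gives a positive density.
  Centring lowers the second moment, so \<open>\<integral>v\<^sup>2 \<le> I\<close>, but it leaves \<open>\<integral>u v = I\<close> unchanged because
  \<open>u\<close> is itself centred.\<close>

lemma admissible_constant_ge_L2:
  assumes M: "prob_space M" and \<alpha>: "2 \<le> \<alpha>" and u: "integrable M u" "(\<integral>x. u x \<partial>M) = 0"
    and c: "admissible_constant \<alpha> M u c"
  shows "(\<integral>\<^sup>+ x. ennreal ((u x)\<^sup>2) \<partial>M) \<le> ennreal ((c * sqrt (\<alpha> / 2))\<^sup>2)"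
proof (rule nn_integral_le_if_truncations_le)
  interpret prob_space M by fact
  show [measurable]: "u \<in> borel_measurable M" using u by auto
  then show "(\<lambda>x. ennreal ((u x)\<^sup>2)) \<in> borel_measurable M" by simp
  have c0: "0 \<le> c" using c by (simp add: admissible_constant_def)
  fix n :: nat
  define w where "w = (\<lambda>x. u x * indicator {x \<in> space M. \<bar>u x\<bar> \<le> real n} x)"
  define m where "m = (\<integral>x. w x \<partial>M)"
  define v where "v = (\<lambda>x. w x - m)"
  define I where "I = (\<integral>x. (w x)\<^sup>2 \<partial>M)"
  have [measurable]: "w \<in> borel_measurable M" "v \<in> borel_measurable M"
    by (auto simp: w_def v_def)
  have w_le: "\<bar>w x\<bar> \<le> real n" for x by (auto simp: w_def split: split_indicator)
  have w_int: "integrable M w"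
    using w_le by (intro integrable_const_bound[of _ "real n"]) auto
  have w2_int: "integrable M (\<lambda>x. (w x)\<^sup>2)"
  proof (rule integrable_const_bound[of _ "(real n)\<^sup>2"])
    show "AE x in M. norm ((w x)\<^sup>2) \<le> (real n)\<^sup>2"
      using w_le by (auto simp: abs_le_square_iff[symmetric])
  qed auto
  have I0: "0 \<le> I" by (simp add: I_def)
  have m_le: "\<bar>m\<bar> \<le> real n"
  proof -
    have "\<bar>m\<bar> \<le> (\<integral>x. \<bar>w x\<bar> \<partial>M)" unfolding m_def by (rule integral_abs_bound)
    also have "\<dots> \<le> (\<integral>x. real n \<partial>M)" using w_int w_le by (intro integral_mono) auto
    finally show ?thesis by (simp add: prob_space)
  qed
  have v_le: "\<bar>v x\<bar> \<le> 2 * real n" for x using w_le[of x] m_le by (simp add: v_def)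
  have v_int: "integrable M v" "(\<integral>x. v x \<partial>M) = 0"
    using w_int by (auto simp: v_def m_def prob_space)
  have v2_eq: "(\<lambda>x. (v x)\<^sup>2) = (\<lambda>x. (w x)\<^sup>2 - 2 * m * w x + m\<^sup>2)"
    by (auto simp: v_def power2_eq_square algebra_simps)
  have v2_int: "integrable M (\<lambda>x. (v x)\<^sup>2)" unfolding v2_eq using w_int w2_int by auto
  have "(\<integral>x. (v x)\<^sup>2 \<partial>M) = I - 2 * m * m + m\<^sup>2"
    unfolding v2_eq using w_int w2_int by (simp add: I_def m_def prob_space)
  then have V_le: "(\<integral>x. (v x)\<^sup>2 \<partial>M) \<le> I" by (simp add: power2_eq_square)
  have uv: "(\<lambda>x. u x * v x) = (\<lambda>x. (w x)\<^sup>2 - m * u x)"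
    by (auto simp: v_def w_def power2_eq_square algebra_simps split: split_indicator)
  have uv_int: "integrable M (\<lambda>x. u x * v x)" "(\<integral>x. u x * v x \<partial>M) = I"
    unfolding uv using u w2_int by (auto simp: I_def)

  have key: "I \<le> c * sqrt (\<alpha> / 2 * (1 + 2 * real n * e) powr (\<alpha> - 2) * I)"
    if e: "0 < e" "2 * real n * e < 1" for e
  proof -
    define \<delta> where "\<delta> = 2 * real n * e"
    define f where "f = (\<lambda>x. 1 + e * v x)"
    have ev: "\<bar>e * v x\<bar> \<le> \<delta>" for x
      using mult_left_mono[OF v_le[of x], of e] e by (simp add: abs_mult \<delta>_def mult_ac)
    have f_nn: "0 \<le> f x" and f_le: "f x \<le> 2" for x
      using ev[of x] e by (auto simp: f_def \<delta>_def)
    have f_powr: "integrable M (\<lambda>x. f x powr \<alpha>)"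
    proof (rule integrable_const_bound[of _ "2 powr \<alpha>"])
      show "AE x in M. norm (f x powr \<alpha>) \<le> 2 powr \<alpha>"
        using f_nn f_le \<alpha> by (auto intro!: powr_mono2)
    qed (simp add: f_def)
    have f: "prob_density \<alpha> M f"
      using f_nn f_powr v_int by (auto simp: prob_density_def f_def prob_space)
    have fu_eq: "(\<lambda>x. f x * u x) = (\<lambda>x. u x + e * (u x * v x))"
      by (auto simp: f_def algebra_simps)
    have fu: "integrable M (\<lambda>x. f x * u x)" "(\<integral>x. f x * u x \<partial>M) = e * I"
      unfolding fu_eq using u uv_int by auto
    define q where "q = \<alpha> * (\<alpha> - 1) / 2 * (1 + \<delta>) powr (\<alpha> - 2) * e\<^sup>2"
    have q0: "0 \<le> q" using \<alpha> by (simp add: q_def)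
    have "(\<integral>x. f x powr \<alpha> \<partial>M) \<le> (\<integral>x. 1 + \<alpha> * e * v x + q * (v x)\<^sup>2 \<partial>M)"
    proof (rule integral_mono[OF f_powr])
      fix x
      show "f x powr \<alpha> \<le> 1 + \<alpha> * e * v x + q * (v x)\<^sup>2"
        using one_plus_powr_le_taylor[OF ev, of \<alpha> x] e \<alpha>
        by (simp add: f_def q_def \<delta>_def power_mult_distrib mult_ac)
    qed (use v_int v2_int in auto)
    also have "\<dots> = 1 + q * (\<integral>x. (v x)\<^sup>2 \<partial>M)"
      using v_int v2_int by (simp add: prob_space)
    also have "\<dots> \<le> 1 + q * I" using V_le q0 by (intro add_left_mono mult_left_mono)
    finally have "((\<integral>x. f x powr \<alpha> \<partial>M) - 1) / (\<alpha> - 1) \<le> q * I / (\<alpha> - 1)"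
      using \<alpha> by (intro divide_right_mono) auto
    also have "\<dots> = e\<^sup>2 * (\<alpha> / 2 * (1 + \<delta>) powr (\<alpha> - 2) * I)"
    proof -
      have eq: "q * I = (\<alpha> - 1) * (e\<^sup>2 * (\<alpha> / 2 * (1 + \<delta>) powr (\<alpha> - 2) * I))" by (simp add: q_def)
      show ?thesis unfolding eq by (rule nonzero_mult_div_cancel_left) (use \<alpha> in simp)
    qed
    finally have T: "((\<integral>x. f x powr \<alpha> \<partial>M) - 1) / (\<alpha> - 1) \<le> e\<^sup>2 * (\<alpha> / 2 * (1 + \<delta>) powr (\<alpha> - 2) * I)" .
    have "\<bar>e * I\<bar> \<le> c * sqrt (((\<integral>x. f x powr \<alpha> \<partial>M) - 1) / (\<alpha> - 1))"
      using admissible_constantD[OF c M _ _ f fu(1)] \<alpha> unfolding fu(2) by simp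
    also have "\<dots> \<le> c * sqrt (e\<^sup>2 * (\<alpha> / 2 * (1 + \<delta>) powr (\<alpha> - 2) * I))"
      using T c0 by (intro mult_left_mono real_sqrt_le_mono)
    also have "\<dots> = e * (c * sqrt (\<alpha> / 2 * (1 + \<delta>) powr (\<alpha> - 2) * I))"
      using e by (simp only: real_sqrt_mult[of "e\<^sup>2"] real_sqrt_abs) simp
    finally have "e * I \<le> e * (c * sqrt (\<alpha> / 2 * (1 + \<delta>) powr (\<alpha> - 2) * I))" by linarith
    then show ?thesis using e by (simp add: \<delta>_def)
  qed
  have "\<forall>\<^sub>F e in at_right 0. I \<le> c * sqrt (\<alpha> / 2 * (1 + 2 * real n * e) powr (\<alpha> - 2) * I)"
  proof -
    have "\<forall>\<^sub>F e in at_right (0::real). e \<in> {0<..<1 / (2 * real n + 1)}"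
      by (rule eventually_at_right_real) auto
    then show ?thesis
    proof eventually_elim
      case (elim e)
      have "2 * real n * e < 1"
      proof -
        have "e * (2 * real n + 1) < 1" using elim by (simp add: field_simps)
        then show ?thesis using elim by (simp add: algebra_simps)
      qed
      then show ?case using key elim by auto
    qed
  qed
  moreover have "((\<lambda>e. c * sqrt (\<alpha> / 2 * (1 + 2 * real n * e) powr (\<alpha> - 2) * I))
      \<longlongrightarrow> c * sqrt (\<alpha> / 2 * (1 + 2 * real n * 0) powr (\<alpha> - 2) * I)) (at_right 0)"
    by (intro tendsto_intros) auto
  ultimately have "I \<le> c * sqrt (\<alpha> / 2 * (1 + 2 * real n * 0) powr (\<alpha> - 2) * I)"
    by (intro tendsto_lowerbound) auto
  also have "\<dots> = c * sqrt (\<alpha> / 2) * sqrt I"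
    by (simp only: real_sqrt_mult) simp
  finally have "sqrt I * sqrt I \<le> c * sqrt (\<alpha> / 2) * sqrt I"
    using I0 by simp
  then have "sqrt I \<le> c * sqrt (\<alpha> / 2)"
  proof (cases "I = 0")
    case True
    then show ?thesis using c0 \<alpha> by simp
  next
    case False
    with I0 have "0 < sqrt I" by simp
    with \<open>sqrt I * sqrt I \<le> _\<close> show ?thesis by (rule mult_right_le_imp_le)
  qed
  then have "(sqrt I)\<^sup>2 \<le> (c * sqrt (\<alpha> / 2))\<^sup>2"
    using I0 by (intro power_mono) auto
  then have I_le: "I \<le> (c * sqrt (\<alpha> / 2))\<^sup>2" using I0 by simp
  have "(\<integral>\<^sup>+ x. ennreal ((u x)\<^sup>2) * indicator {x \<in> space M. \<bar>u x\<bar> \<le> real n} x \<partial>M)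
      = (\<integral>\<^sup>+ x. ennreal ((w x)\<^sup>2) \<partial>M)"
    by (intro nn_integral_cong) (auto simp: w_def split: split_indicator)
  also have "\<dots> = ennreal I"
    unfolding I_def using w2_int by (intro nn_integral_eq_integral) auto
  finally show "(\<integral>\<^sup>+ x. ennreal ((u x)\<^sup>2) * indicator {x \<in> space M. \<bar>u x\<bar> \<le> real n} x \<partial>M)
      \<le> ennreal ((c * sqrt (\<alpha> / 2))\<^sup>2)"
    using I_le by (simp add: ennreal_leI)
qed

lemma admissible_constant_uminus:
  assumes "admissible_constant \<alpha> M u c"
  shows "admissible_constant \<alpha> M (\<lambda>x. - u x) c"
  using assms by (simp add: admissible_constant_def)

text \<open>With \<open>g = l u\<^sup>\<beta>\<^sup>-\<^sup>1\<close> on \<open>S\<close>, both \<open>u g = l u\<^sup>\<beta>\<close> and \<open>g\<^sup>\<alpha> = l\<^sup>\<alpha> u\<^sup>\<beta>\<close> reduce to the integral \<open>I\<close>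
  of \<open>u\<^sup>\<beta>\<close> over \<open>S\<close>. For \<open>f = (1 + g) / (1 + m)\<close> with \<open>m = \<integral>g\<close>, the terms \<open>1 + \<alpha> m\<close> in
  \<open>\<integral>(1 + g)\<^sup>\<alpha> \<le> 1 + \<alpha> m + l\<^sup>\<alpha> I\<close> are absorbed by \<open>(1 + m)\<^sup>\<alpha>\<close>, so the divergence is at most
  \<open>l\<^sup>\<alpha> I / ((\<alpha> - 1)(1 + m)\<^sup>\<alpha>)\<close>. The assumed inequality for \<open>f\<close> then bounds \<open>r\<^sup>2\<^sup>-\<^sup>\<alpha> I\<^sup>\<alpha>\<^sup>-\<^sup>1\<close>, and the
  power \<open>\<beta> - 1 = 1 / (\<alpha> - 1)\<close> of that bound is the claim.\<close>

lemma admissible_constant_ge_one_sided_tail: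
  fixes \<alpha> \<beta> c r :: real
  assumes M: "prob_space M" and \<alpha>: "1 < \<alpha>" "\<alpha> \<le> 2" and \<beta>: "\<beta> = \<alpha> / (\<alpha> - 1)"
    and u: "integrable M u" "(\<integral>x. u x \<partial>M) = 0"
    and c: "admissible_constant \<alpha> M u c" and r: "0 < r"
  shows "(\<integral>\<^sup>+ x. ennreal (r powr (\<beta> - 2) * (u x powr \<beta> * indicator {x \<in> space M. r \<le> u x} x)) \<partial>M)
     \<le> ennreal (c powr (2 * \<beta> - 2) * (2 * \<beta>) powr (\<beta> - 1))"
proof (rule nn_integral_le_if_truncations_le)
  interpret prob_space M by fact
  show [measurable]: "u \<in> borel_measurable M" using u by auto
  then show "(\<lambda>x. ennreal (r powr (\<beta> - 2) * (u x powr \<beta> * indicator {x \<in> space M. r \<le> u x} x))) \<in> borel_measurable M" by simp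
  have c0: "0 \<le> c" using c by (simp add: admissible_constant_def)
  have \<beta>2: "2 \<le> \<beta>" using \<alpha> by (simp add: \<beta> pos_le_divide_eq)
  have \<beta>\<alpha>: "(\<beta> - 1) * \<alpha> = \<beta>" "(\<beta> - 1) * (\<alpha> - 1) = 1" "(2 - \<alpha>) * (\<beta> - 1) = \<beta> - 2"
    using \<alpha> by (auto simp: \<beta> field_simps)
  fix n :: nat
  define S where "S = {x \<in> space M. r \<le> u x \<and> u x \<le> real n}"
  have [measurable]: "S \<in> sets M" by (simp add: S_def)
  define I where "I = (\<integral>x. u x powr \<beta> * indicator S x \<partial>M)"
  have powr_int: "integrable M (\<lambda>x. u x powr p * indicator S x)" if "0 \<le> p" for p
  proof (rule integrable_const_bound[of _ "real n powr p"])
    show "AE x in M. norm (u x powr p * indicator S x) \<le> real n powr p"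
      using that r by (auto simp: S_def intro!: powr_mono2 split: split_indicator)
  qed auto
  have I0: "0 \<le> I" by (auto simp: I_def)
  have I_le: "r powr (\<beta> - 2) * I \<le> c powr (2 * \<beta> - 2) * (2 * \<beta>) powr (\<beta> - 1)"
  proof (cases "I = 0")
    case True
    then show ?thesis by simp
  next
    case False
    then have I: "0 < I" using I0 by simp
    \<comment> \<open>As \<open>u \<ge> r\<close> on \<open>S\<close>, the mass of \<open>g\<close> is at most \<open>l I / r\<close>; this is the largest \<open>l\<close> for which
      that bound does not exceed \<open>1\<close>, so the normalisation costs only a factor \<open>2\<close>.\<close>
    define l where "l = r / I"
    have l: "0 < l" using r I by (simp add: l_def)
    define g where "g = (\<lambda>x. l * (u x powr (\<beta> - 1) * indicator S x))"
    have g_nn: "0 \<le> g x" for x using l by (auto simp: g_def)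
    have g_int: "integrable M g" using powr_int[of "\<beta> - 1"] \<beta>2 by (simp add: g_def)
    define m where "m = (\<integral>x. g x \<partial>M)"
    have m0: "0 \<le> m" using g_nn by (simp add: m_def)
    have "m \<le> (\<integral>x. l / r * (u x powr \<beta> * indicator S x) \<partial>M)"
      unfolding m_def
    proof (rule integral_mono[OF g_int])
      fix x
      have "r * u x powr (\<beta> - 1) \<le> u x powr \<beta>" if "x \<in> S"
      proof -
        have "r * u x powr (\<beta> - 1) \<le> u x * u x powr (\<beta> - 1)"
          using that by (intro mult_right_mono) (auto simp: S_def)
        also have "\<dots> = u x powr \<beta>" using that r by (simp add: S_def powr_diff)
        finally show ?thesis .
      qed
      then show "g x \<le> l / r * (u x powr \<beta> * indicator S x)"
        using l r by (auto simp: g_def field_simps split: split_indicator)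
    qed (use powr_int[of \<beta>] \<beta>2 in auto)
    also have "\<dots> = 1" using I r by (simp add: l_def flip: I_def)
    finally have m1: "m \<le> 1" .
    have g_powr: "(\<lambda>x. g x powr \<alpha>) = (\<lambda>x. l powr \<alpha> * (u x powr \<beta> * indicator S x))"
      using l by (auto simp: g_def powr_mult powr_powr \<beta>\<alpha> split: split_indicator)
    have g_powr_int: "integrable M (\<lambda>x. g x powr \<alpha>)" "(\<integral>x. g x powr \<alpha> \<partial>M) = l powr \<alpha> * I"
      unfolding g_powr using powr_int[of \<beta>] \<beta>2 by (auto simp: I_def)
    have ug_eq: "(\<lambda>x. u x * g x) = (\<lambda>x. l * (u x powr \<beta> * indicator S x))"
    proof
      fix x
      have "u x * u x powr (\<beta> - 1) = u x powr \<beta>" if "x \<in> S"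
        using that r by (simp add: S_def powr_diff)
      then show "u x * g x = l * (u x powr \<beta> * indicator S x)"
        by (auto simp: g_def split: split_indicator)
    qed
    have ug_int: "integrable M (\<lambda>x. u x * g x)" "(\<integral>x. u x * g x \<partial>M) = l * I"
      unfolding ug_eq using powr_int[of \<beta>] \<beta>2 by (auto simp: I_def)
    define f where "f = (\<lambda>x. (1 + g x) / (1 + m))"
    have f_nn: "0 \<le> f x" for x using g_nn[of x] m0 by (simp add: f_def)
    have f_powr: "f x powr \<alpha> \<le> (1 + \<alpha> * g x + g x powr \<alpha>) / (1 + m) powr \<alpha>" for x
      using one_plus_powr_le[OF g_nn \<alpha>, of x] g_nn[of x] m0
      by (simp add: f_def powr_divide divide_right_mono)
    have F_int: "integrable M (\<lambda>x. (1 + \<alpha> * g x + g x powr \<alpha>) / (1 + m) powr \<alpha>)"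
      using g_int g_powr_int by auto
    have f_powr_int: "integrable M (\<lambda>x. f x powr \<alpha>)"
    proof (rule Bochner_Integration.integrable_bound[OF F_int])
      show "(\<lambda>x. f x powr \<alpha>) \<in> borel_measurable M" by (simp add: f_def g_def)
      show "AE x in M. norm (f x powr \<alpha>) \<le> norm ((1 + \<alpha> * g x + g x powr \<alpha>) / (1 + m) powr \<alpha>)"
      proof (rule AE_I2)
        fix x
        have "0 \<le> 1 + \<alpha> * g x + g x powr \<alpha>"
          using g_nn[of x] \<alpha> by (intro add_nonneg_nonneg) auto
        then show "norm (f x powr \<alpha>) \<le> norm ((1 + \<alpha> * g x + g x powr \<alpha>) / (1 + m) powr \<alpha>)"
          using f_powr[of x] by simp
      qed
    qed
    have f: "prob_density \<alpha> M f"
      using f_nn f_powr_int g_int m0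
      by (auto simp: prob_density_def f_def prob_space simp flip: m_def)
    have fu_eq: "(\<lambda>x. f x * u x) = (\<lambda>x. (u x + u x * g x) / (1 + m))"
      by (auto simp: f_def algebra_simps)
    have fu: "integrable M (\<lambda>x. f x * u x)" "(\<integral>x. f x * u x \<partial>M) = l * I / (1 + m)"
      unfolding fu_eq using u ug_int by auto
    have "(\<integral>x. f x powr \<alpha> \<partial>M) \<le> (\<integral>x. (1 + \<alpha> * g x + g x powr \<alpha>) / (1 + m) powr \<alpha> \<partial>M)"
      using f_powr by (intro integral_mono f_powr_int F_int)
    also have "\<dots> = (1 + \<alpha> * m + l powr \<alpha> * I) / (1 + m) powr \<alpha>"
      using g_int g_powr_int by (simp add: prob_space flip: m_def)
    also have "\<dots> \<le> ((1 + m) powr \<alpha> + l powr \<alpha> * I) / (1 + m) powr \<alpha>"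
      using powr_ge_tangent[of "1 + m" \<alpha>] m0 \<alpha> by (intro divide_right_mono) auto
    also have "\<dots> = 1 + l powr \<alpha> * I / (1 + m) powr \<alpha>"
      using m0 by (simp add: add_divide_distrib)
    finally have T: "((\<integral>x. f x powr \<alpha> \<partial>M) - 1) / (\<alpha> - 1) \<le> l powr \<alpha> * I / (1 + m) powr \<alpha> / (\<alpha> - 1)"
      using \<alpha> by (intro divide_right_mono) auto
    have "\<bar>l * I / (1 + m)\<bar> \<le> c * sqrt (((\<integral>x. f x powr \<alpha> \<partial>M) - 1) / (\<alpha> - 1))"
      using admissible_constantD[OF c M _ _ f fu(1)] \<alpha> unfolding fu(2) by simp
    also have "\<dots> \<le> c * sqrt (l powr \<alpha> * I / (1 + m) powr \<alpha> / (\<alpha> - 1))"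
      using T c0 by (intro mult_left_mono real_sqrt_le_mono)
    finally have "(l * I / (1 + m))\<^sup>2 \<le> (c * sqrt (l powr \<alpha> * I / (1 + m) powr \<alpha> / (\<alpha> - 1)))\<^sup>2"
      using l I m0 by (intro power_mono) auto
    then have "(r / (1 + m))\<^sup>2 \<le> c\<^sup>2 * (l powr \<alpha> * I / (1 + m) powr \<alpha> / (\<alpha> - 1))"
      using l I m0 \<alpha> by (simp add: l_def power_mult_distrib)
    also have "c\<^sup>2 * (l powr \<alpha> * I / (1 + m) powr \<alpha> / (\<alpha> - 1))
        = c\<^sup>2 * (\<beta> - 1) * (l powr \<alpha> * I / (1 + m) powr \<alpha>)"
    proof -
      have "\<beta> - 1 = inverse (\<alpha> - 1)" using \<alpha> by (simp add: \<beta> field_simps)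
      then show ?thesis by (simp add: divide_inverse)
    qed
    finally have "r\<^sup>2 \<le> c\<^sup>2 * (\<beta> - 1) * (l powr \<alpha> * I / (1 + m) powr \<alpha>) * (1 + m)\<^sup>2"
      using m0 by (simp add: power_divide pos_divide_le_eq)
    also have "\<dots> = c\<^sup>2 * (\<beta> - 1) * (r powr \<alpha> * I powr (1 - \<alpha>)) * (1 + m) powr (2 - \<alpha>)"
      using m0 r I by (simp add: l_def powr_divide powr_diff)
    also have "\<dots> \<le> c\<^sup>2 * \<beta> * (r powr \<alpha> * I powr (1 - \<alpha>)) * 2"
    proof (intro mult_mono)
      have "(1 + m) powr (2 - \<alpha>) \<le> 2 powr (2 - \<alpha>)" using m0 m1 \<alpha> by (intro powr_mono2) auto
      also have "\<dots> \<le> 2 powr 1" using \<alpha> by (intro powr_mono) auto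
      finally show "(1 + m) powr (2 - \<alpha>) \<le> 2" by simp
    qed (use \<beta>2 in auto)
    finally have "r\<^sup>2 * (r powr (- \<alpha>) * I powr (\<alpha> - 1))
        \<le> c\<^sup>2 * \<beta> * (r powr \<alpha> * I powr (1 - \<alpha>)) * 2 * (r powr (- \<alpha>) * I powr (\<alpha> - 1))"
      by (intro mult_right_mono) auto
    also have "\<dots> = c\<^sup>2 * \<beta> * 2 * (r powr \<alpha> * r powr (- \<alpha>)) * (I powr (1 - \<alpha>) * I powr (\<alpha> - 1))"
      by (simp add: mult_ac)
    also have "\<dots> = c\<^sup>2 * (2 * \<beta>)" using r I by (simp flip: powr_add)
    also have "r\<^sup>2 * (r powr (- \<alpha>) * I powr (\<alpha> - 1)) = r powr (2 - \<alpha>) * I powr (\<alpha> - 1)"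
      using r by (simp add: powr_diff powr_minus field_simps)
    finally have "(r powr (2 - \<alpha>) * I powr (\<alpha> - 1)) powr (\<beta> - 1) \<le> (c\<^sup>2 * (2 * \<beta>)) powr (\<beta> - 1)"
      using \<beta>2 by (intro powr_mono2) auto
    also have "(r powr (2 - \<alpha>) * I powr (\<alpha> - 1)) powr (\<beta> - 1) = r powr (\<beta> - 2) * I"
      using r I \<beta>\<alpha> by (simp add: powr_mult powr_powr mult.commute[of "\<alpha> - 1"])
    also have "(c\<^sup>2 * (2 * \<beta>)) powr (\<beta> - 1) = (c powr 2) powr (\<beta> - 1) * (2 * \<beta>) powr (\<beta> - 1)"
      using c0 \<beta>2 by (simp add: powr_mult)
    also have "(c powr 2) powr (\<beta> - 1) = c powr (2 * \<beta> - 2)"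
      by (simp add: powr_powr algebra_simps)
    finally show ?thesis .
  qed
  have "(\<integral>\<^sup>+ x. ennreal (r powr (\<beta> - 2) * (u x powr \<beta> * indicator {x \<in> space M. r \<le> u x} x))
          * indicator {x \<in> space M. \<bar>u x\<bar> \<le> real n} x \<partial>M)
      = (\<integral>\<^sup>+ x. ennreal (r powr (\<beta> - 2) * (u x powr \<beta> * indicator S x)) \<partial>M)"
    using r by (intro nn_integral_cong) (auto simp: S_def split: split_indicator)
  also have "\<dots> = ennreal (\<integral>x. r powr (\<beta> - 2) * (u x powr \<beta> * indicator S x) \<partial>M)"
    using powr_int[of \<beta>] \<beta>2 by (intro nn_integral_eq_integral) auto
  also have "\<dots> = ennreal (r powr (\<beta> - 2) * I)" by (simp add: I_def)
  finally show "(\<integral>\<^sup>+ x. ennreal (r powr (\<beta> - 2) * (u x powr \<beta> * indicator {x \<in> space M. r \<le> u x} x))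
          * indicator {x \<in> space M. \<bar>u x\<bar> \<le> real n} x \<partial>M)
      \<le> ennreal (c powr (2 * \<beta> - 2) * (2 * \<beta>) powr (\<beta> - 1))"
    using I_le by (simp add: ennreal_leI)
qed

text \<open>Adding the one-sided tails of \<open>u\<close> and \<open>-u\<close> doubles the bound; the factor \<open>4 \<beta>\<^sup>\<beta>\<close> in the claim,
  raised to the power \<open>2 \<beta> - 2\<close>, absorbs this and the constant \<open>(2 \<beta>)\<^sup>\<beta>\<^sup>-\<^sup>1\<close> generously.\<close>

lemma admissible_constant_ge_K_const:
  fixes \<alpha> \<beta> c :: real
  assumes M: "prob_space M" and \<alpha>: "1 < \<alpha>" "\<alpha> \<le> 2" and \<beta>: "\<beta> = \<alpha> / (\<alpha> - 1)"
    and u: "integrable M u" "(\<integral>x. u x \<partial>M) = 0"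
    and c: "admissible_constant \<alpha> M u c"
  shows "K_const \<beta> M u \<le> ennreal (4 * \<beta> powr \<beta> * c)"
proof -
  have c0: "0 \<le> c" using c by (simp add: admissible_constant_def)
  have \<beta>2: "2 \<le> \<beta>" using \<alpha> by (simp add: \<beta> pos_le_divide_eq)
  have [measurable]: "u \<in> borel_measurable M" using u by auto
  let ?B = "c powr (2 * \<beta> - 2) * (2 * \<beta>) powr (\<beta> - 1)"
  have B_le: "?B + ?B \<le> (4 * \<beta> powr \<beta> * c) powr (2 * \<beta> - 2)"
  proof -
    have "(2::real) powr 1 \<le> 2 powr (\<beta> - 1)" using \<beta>2 by (intro powr_mono) auto
    then have "2 * ?B \<le> 2 powr (\<beta> - 1) * ?B" by (intro mult_right_mono) auto
    then have "?B + ?B \<le> c powr (2 * \<beta> - 2) * (2 powr (\<beta> - 1) * (2 * \<beta>) powr (\<beta> - 1))"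
      by (simp add: mult_ac)
    also have "2 powr (\<beta> - 1) * (2 * \<beta>) powr (\<beta> - 1) = (4 * \<beta>) powr (\<beta> - 1)"
      using \<beta>2 by (simp flip: powr_mult)
    also have "\<dots> \<le> ((4 * \<beta> powr \<beta>) powr 2) powr (\<beta> - 1)"
    proof (rule powr_mono2)
      have b: "\<beta> powr 1 \<le> \<beta> powr \<beta>" using \<beta>2 by (intro powr_mono) auto
      then have "4 * \<beta> * 1 \<le> (4 * \<beta> powr \<beta>) * (4 * \<beta> powr \<beta>)"
        using \<beta>2 by (intro mult_mono) auto
      then show "4 * \<beta> \<le> (4 * \<beta> powr \<beta>) powr 2" by (simp add: power2_eq_square)
    qed (use \<beta>2 in auto)
    also have "\<dots> = (4 * \<beta> powr \<beta>) powr (2 * \<beta> - 2)"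
      by (simp only: powr_powr) (simp add: algebra_simps)
    also have "c powr (2 * \<beta> - 2) * (4 * \<beta> powr \<beta>) powr (2 * \<beta> - 2) = (4 * \<beta> powr \<beta> * c) powr (2 * \<beta> - 2)"
      using c0 by (subst powr_mult[of _ c]) auto
    finally show ?thesis by (simp add: mult_left_mono)
  qed
  have "ennreal (r powr (\<beta> - 2)) *
       (\<integral>\<^sup>+ x\<in>{x \<in> space M. r \<le> \<bar>u x\<bar>}. ennreal (\<bar>u x\<bar> powr \<beta>) \<partial>M) \<le> ennreal ((4 * \<beta> powr \<beta> * c) powr (2 * \<beta> - 2))"
    if r: "0 < r" for r
  proof -
    let ?tail = "\<lambda>u x. ennreal (r powr (\<beta> - 2) * (u x powr \<beta> * indicator {x \<in> space M. r \<le> u x} x))"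
    have "ennreal (r powr (\<beta> - 2)) *
       (\<integral>\<^sup>+ x\<in>{x \<in> space M. r \<le> \<bar>u x\<bar>}. ennreal (\<bar>u x\<bar> powr \<beta>) \<partial>M)
       = (\<integral>\<^sup>+ x. ennreal (r powr (\<beta> - 2)) *
            (ennreal (\<bar>u x\<bar> powr \<beta>) * indicator {x \<in> space M. r \<le> \<bar>u x\<bar>} x) \<partial>M)"
      by (subst nn_integral_cmult) auto
    also have "\<dots> \<le> (\<integral>\<^sup>+ x. ?tail u x + ?tail (\<lambda>x. - u x) x \<partial>M)"
      using r by (intro nn_integral_mono) (auto simp: ennreal_mult abs_if split: split_indicator)
    also have "\<dots> = (\<integral>\<^sup>+ x. ?tail u x \<partial>M) + (\<integral>\<^sup>+ x. ?tail (\<lambda>x. - u x) x \<partial>M)"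
      by (rule nn_integral_add) auto
    also have "\<dots> \<le> ennreal ?B + ennreal ?B"
      using u by (intro add_mono
          admissible_constant_ge_one_sided_tail[OF M \<alpha> \<beta> u c r]
          admissible_constant_ge_one_sided_tail[OF M \<alpha> \<beta> _ _ admissible_constant_uminus[OF c] r]) auto
    also have "\<dots> = ennreal (?B + ?B)" by (rule ennreal_plus[symmetric]) auto
    also have "\<dots> \<le> ennreal ((4 * \<beta> powr \<beta> * c) powr (2 * \<beta> - 2))" using B_le by (rule ennreal_leI)
    finally show ?thesis .
  qed
  then show ?thesis using c0 \<beta>2 by (subst K_const_le_iff) auto
qed

theorem theorem2p3:
  fixes M :: "'a measure" and u :: "'a \<Rightarrow> real" and \<alpha> \<beta> :: real
  assumes "prob_space M"
    and "1 < \<alpha>"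
    and "\<beta> = \<alpha> / (\<alpha> - 1)"
    and "integrable M u"
    and "(\<integral>x. u x \<partial>M) = 0"
  shows "(\<alpha> \<le> 2 \<longrightarrow>
            ennreal (1 / 4 * \<beta> powr (- \<beta>)) * K_const \<beta> M u \<le> best_constant \<alpha> M u \<and>
            best_constant \<alpha> M u \<le> ennreal (2 * \<beta> powr \<beta>) * K_const \<beta> M u) \<and>
         (2 \<le> \<alpha> \<longrightarrow>
            ennreal (sqrt (2 / \<alpha>)) * L2_norm M u \<le> best_constant \<alpha> M u \<and>
            best_constant \<alpha> M u \<le> L2_norm M u)"
proof (intro conjI impI)
  have \<beta>: "0 < \<beta>" using assms by simp
  show "ennreal (1 / 4 * \<beta> powr (- \<beta>)) * K_const \<beta> M u \<le> best_constant \<alpha> M u" if "\<alpha> \<le> 2"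
  proof (rule best_constant_ge)
    fix c assume c: "admissible_constant \<alpha> M u c"
    then have "0 \<le> c" by (simp add: admissible_constant_def)
    have "ennreal (1 / 4 * \<beta> powr (- \<beta>)) * K_const \<beta> M u
        \<le> ennreal (1 / 4 * \<beta> powr (- \<beta>)) * ennreal (4 * \<beta> powr \<beta> * c)"
      using admissible_constant_ge_K_const[OF assms(1,2) that assms(3-5) c] by (rule mult_left_mono) simp
    also have "\<dots> = ennreal c"
      using \<beta> \<open>0 \<le> c\<close> by (simp add: powr_minus flip: ennreal_mult)
    finally show "ennreal (1 / 4 * \<beta> powr (- \<beta>)) * K_const \<beta> M u \<le> ennreal c" .
  qed
  show "best_constant \<alpha> M u \<le> ennreal (2 * \<beta> powr \<beta>) * K_const \<beta> M u" if "\<alpha> \<le> 2"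
    using assms that \<beta> by (intro best_constant_le admissible_constant_K_const) auto
  show "ennreal (sqrt (2 / \<alpha>)) * L2_norm M u \<le> best_constant \<alpha> M u" if "2 \<le> \<alpha>"
  proof (rule best_constant_ge)
    fix c assume c: "admissible_constant \<alpha> M u c"
    then have "0 \<le> c" by (simp add: admissible_constant_def)
    then have "L2_norm M u \<le> ennreal (c * sqrt (\<alpha> / 2))"
      using admissible_constant_ge_L2[OF assms(1) that assms(4,5) c] that
      by (subst L2_norm_le_iff) auto
    then have "ennreal (sqrt (2 / \<alpha>)) * L2_norm M u
        \<le> ennreal (sqrt (2 / \<alpha>)) * ennreal (c * sqrt (\<alpha> / 2))"
      by (rule mult_left_mono) simp
    also have "\<dots> = ennreal (c * (sqrt (2 / \<alpha>) * sqrt (\<alpha> / 2)))"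
      using \<open>0 \<le> c\<close> that by (simp add: mult_ac flip: ennreal_mult)
    also have "sqrt (2 / \<alpha>) * sqrt (\<alpha> / 2) = 1"
      using that by (simp flip: real_sqrt_mult)
    finally show "ennreal (sqrt (2 / \<alpha>)) * L2_norm M u \<le> ennreal c" by simp
  qed
  have "best_constant \<alpha> M u \<le> ennreal 1 * L2_norm M u" if "2 \<le> \<alpha>"
  proof (rule best_constant_le)
    fix k :: real assume "0 < k" "L2_norm M u \<le> ennreal k"
    then have "admissible_constant \<alpha> M u k"
      using assms that by (intro admissible_constant_L2) (auto simp: L2_norm_le_iff)
    then show "admissible_constant \<alpha> M u (1 * k)" by simp
  qed auto
  then show "best_constant \<alpha> M u \<le> L2_norm M u" if "2 \<le> \<alpha>" using that by simp
qed

end
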